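(* For any integers $u,v>0$ and any partition $\mu$, $$D_{u,v}\,s_\mu\Big[\frac{X}{1-q}\Big]=(q^u-1)\sum_{i=1}^{|\mu|+v}q^{u\,p(\mu)_i+v-ui}\;s_{p(\mu)+ve_i}\Big[\frac{X}{1-q}\Big],$$ where $p(\mu)$ is the weak composition of length $|\mu|+v$ obtained by appending zeros to the parts of $\mu$, and $e_i$ is the $i$-th coordinate vector of length $|\mu|+v$.
   Context: Let $\Lambda$ be the ring of symmetric functions in $X=x_1+x_2+\cdots$ over $\mathbb{Q}(q)$, with plethystic notation: $p_k[E]$ replaces every variable in $E$ (including $q$ and an auxiliary $z$) by its $k$-th power, $F[E]$ substitutes $p_k\mapsto p_k[E]$, and $\Omega[E]=\exp(\sum_{k\ge1}p_k[E]/k)$. For an integer $u$, $[u]_q=(1-q^u)/(1-q)$; $t=1/q$, $[u]_t=(1-q^{-u})/(1-q^{-1})$, $M=(1-t)(1-q)$. For integers $u,v$, $D_{u,v}F[X]=F[X+M[u]_q/z]\,\Omega[-z[u]_tX]\big|_{z^v}$ (coefficient of $z^v$). For $\alpha\in\mathbb{Z}_{\ge0}^N$ and $\delta_N=(N-1,N-2,\dots,0)$, $s_\alpha$ denotes $0$ if $\alpha+\delta_N$ has a repeated entry, and otherwise $\epsilon\, s_\lambda$, where $\lambda$ is the partition such that sorting $\alpha+\delta_N$ decreasingly gives $\lambda+\delta_N$ and $\epsilon$ is the sign of the sorting permutation. *)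

theory Defs
  imports
    "HOL-Library.Poly_Mapping"
    "HOL-Combinatorics.Permutations"
    "HOL-Computational_Algebra.Normalized_Fraction"
    "HOL-Computational_Algebra.Polynomial_Factorial"
    "HOL-Computational_Algebra.Field_as_Ring"
    "HOL-Computational_Algebra.Formal_Laurent_Series"
    "Jordan_Normal_Form.Determinant"
begin

type_synonym qfield = "rat poly fract"

definition q :: qfield where
  "q = Fract (monom 1 1) 1"

definition t :: qfield where
  "t = 1 / q"

definition M :: qfield where
  "M = (1 - t) * (1 - q)"

definition bracket :: "qfield \<Rightarrow> int \<Rightarrow> qfield" where
  "bracket a u = (1 - a powi u) / (1 - a)"


text \<open>
  Plethysm is defined through the fact that the ring of symmetric functions over
  \<open>\<rat>(q)\<close> is the polynomial ring \<open>\<rat>(q)[p\<^sub>1, p\<^sub>2, \<dots>]\<close> on the power sums, and this is the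
  form in which it is represented here.  The power sums are the variables; to have
  no junk variable \<open>p\<^sub>0\<close>, the variable with index \<open>i\<close> stands for \<open>p\<^bsub>i+1\<^esub>\<close>.
  The link with the variables \<open>x\<^sub>1, x\<^sub>2, \<dots>\<close> is \<open>realize\<close> below.
\<close>

type_synonym symfun = "(nat \<Rightarrow>\<^sub>0 nat) \<Rightarrow>\<^sub>0 qfield"

definition scal :: "qfield \<Rightarrow> ((nat \<Rightarrow>\<^sub>0 nat) \<Rightarrow>\<^sub>0 qfield)" where
  "scal c = Poly_Mapping.single 0 c"

definition var :: "nat \<Rightarrow> ((nat \<Rightarrow>\<^sub>0 nat) \<Rightarrow>\<^sub>0 qfield)" where
  "var i = Poly_Mapping.single (Poly_Mapping.single i 1) 1"

definition psum :: "nat \<Rightarrow> symfun" where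
  "psum k = var (k - 1)"

text \<open>
  \<open>subst_psum c g F\<close> is the image of \<open>F\<close> under the ring homomorphism that is \<open>c\<close> on the
  scalars and sends \<open>p\<^sub>k\<close> to \<open>g k\<close> (for \<open>k \<ge> 1\<close>).
\<close>

definition subst_psum ::
  "(qfield \<Rightarrow> 'r) \<Rightarrow> (nat \<Rightarrow> 'r) \<Rightarrow> symfun \<Rightarrow> 'r :: comm_ring_1" where
  "subst_psum c g F =
     (\<Sum>m\<in>Poly_Mapping.keys F. c (Poly_Mapping.lookup F m) *
        (\<Prod>i\<in>Poly_Mapping.keys m. g (Suc i) ^ Poly_Mapping.lookup m i))"


text \<open>
  The polynomial \<open>F(x\<^sub>1, \<dots>, x\<^sub>N)\<close>.  Here the same type is used for polynomials in the
  variables \<open>x\<close>, with \<open>var i\<close> playing the role of \<open>x\<^bsub>i+1\<^esub>\<close>.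
\<close>

definition realize :: "nat \<Rightarrow> symfun \<Rightarrow> ((nat \<Rightarrow>\<^sub>0 nat) \<Rightarrow>\<^sub>0 qfield)" where
  "realize N F = subst_psum scal (\<lambda>k. \<Sum>i<N. var i ^ k) F"

definition alternant :: "nat \<Rightarrow> (nat \<Rightarrow> nat) \<Rightarrow> ((nat \<Rightarrow>\<^sub>0 nat) \<Rightarrow>\<^sub>0 qfield)" where
  "alternant N a = det (mat N N (\<lambda>(i, j). var i ^ a j))"

definition is_partition :: "nat list \<Rightarrow> bool" where
  "is_partition \<nu> \<longleftrightarrow> sorted_wrt (\<ge>) \<nu> \<and> 0 \<notin> set \<nu>"

definition part :: "nat list \<Rightarrow> nat \<Rightarrow> nat" where
  "part \<nu> i = (if i < length \<nu> then \<nu> ! i else 0)"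

text \<open>
  Schur functions by the bialternant formula
  \<open>s\<^sub>\<nu>(x\<^sub>1, \<dots>, x\<^sub>N) = a\<^bsub>\<nu>+\<delta>\<^esub> / a\<^bsub>\<delta>\<^esub>\<close>, required in all large enough sets of variables.
\<close>

definition schur :: "nat list \<Rightarrow> symfun" where
  "schur \<nu> = (THE F. \<forall>N \<ge> length \<nu>.
     realize N F * alternant N (\<lambda>j. N - 1 - j) =
     alternant N (\<lambda>j. part \<nu> j + (N - 1 - j)))"

definition plus_delta :: "nat list \<Rightarrow> nat list" where
  "plus_delta \<alpha> = map (\<lambda>i. \<alpha> ! i + (length \<alpha> - 1 - i)) [0..<length \<alpha>]"

definition sort_desc :: "nat list \<Rightarrow> nat list" where
  "sort_desc b = rev (sort b)"

definition sort_sign :: "nat list \<Rightarrow> int" where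
  "sort_sign b =
     sign (THE \<pi>. \<pi> permutes {..<length b} \<and>
                  (\<forall>i < length b. sort_desc b ! i = b ! \<pi> i))"

text \<open>
  The partition \<open>\<nu>\<close> with \<open>\<nu> + \<delta> = c\<close> for a strictly decreasing \<open>c\<close>, so that the
  subtraction does not truncate; trailing zeros are dropped.
\<close>

definition minus_delta :: "nat list \<Rightarrow> nat list" where
  "minus_delta c =
     filter (\<lambda>k. k \<noteq> 0) (map (\<lambda>i. c ! i - (length c - 1 - i)) [0..<length c])"

definition schur_comp :: "nat list \<Rightarrow> symfun" where
  "schur_comp \<alpha> =
     (let b = plus_delta \<alpha> in
      if distinct b
      then of_int (sort_sign b) * schur (minus_delta (sort_desc b))
      else 0)"


text \<open>
  The operations \<open>E \<mapsto> p\<^sub>k[E]\<close>, for \<open>k \<ge> 1\<close>, on \<open>\<rat>(q)\<close>, on symmetric functions and on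
  Laurent series in \<open>z\<close> with symmetric function coefficients: \<open>q\<close>, \<open>z\<close> and the \<open>x\<^sub>i\<close>
  (hence \<open>p\<^sub>j \<mapsto> p\<^bsub>jk\<^esub>\<close>) are replaced by their \<open>k\<close>-th powers.
\<close>

definition adams_q :: "nat \<Rightarrow> qfield \<Rightarrow> qfield" where
  "adams_q k r =
     (let (a, b) = quot_of_fract r
      in Fract (pcompose a (monom 1 k)) (pcompose b (monom 1 k)))"

definition adams :: "nat \<Rightarrow> symfun \<Rightarrow> symfun" where
  "adams k E = subst_psum (\<lambda>c. scal (adams_q k c)) (\<lambda>j. psum (j * k)) E"

definition adams_z :: "nat \<Rightarrow> symfun fls \<Rightarrow> symfun fls" where
  "adams_z k E = fls_compose_power (Abs_fls (\<lambda>n. adams k (fls_nth E n))) k"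

definition scal_z :: "qfield \<Rightarrow> symfun fls" where
  "scal_z c = fls_const (scal c)"

definition pleth :: "symfun \<Rightarrow> symfun \<Rightarrow> symfun" where
  "pleth F E = subst_psum scal (\<lambda>k. adams k E) F"

definition pleth_z :: "symfun \<Rightarrow> symfun fls \<Rightarrow> symfun fls" where
  "pleth_z F E = subst_psum scal_z (\<lambda>k. adams_z k E) F"

text \<open>
  \<open>\<Omega>[E] = exp (\<Sum>k\<ge>1. p\<^sub>k[E] / k)\<close>.  Both infinite sums are limits in the \<open>z\<close>-adic metric
  on Laurent series; they converge when \<open>E\<close> has only positive powers of \<open>z\<close>.
\<close>

definition exp_z :: "symfun fls \<Rightarrow> symfun fls" where
  "exp_z E = suminf (\<lambda>n. scal_z (1 / fact n) * E ^ n)"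

definition Omega :: "symfun fls \<Rightarrow> symfun fls" where
  "Omega E = exp_z (suminf (\<lambda>k. scal_z (1 / of_nat (Suc k)) * adams_z (Suc k) E))"

definition X :: symfun where
  "X = psum 1"

definition D :: "int \<Rightarrow> int \<Rightarrow> symfun \<Rightarrow> symfun" where
  "D u v F =
     fls_nth
       (pleth_z F (fls_const X + scal_z (M * bracket q u) * fls_X_inv) *
        Omega (- (fls_X * scal_z (bracket t u) * fls_const X)))
       v"

end

(*
  Put y = X/(1-q) and a = q^u.  The operator becomes the coefficient of z^v in
  s_mu[y + (a-1)/(qz)] Omega[zq(1 - 1/a)y].  It suffices to compare both sides at all points
  (y_1, ..., y_n) with distinct nonzero coordinates, for all large n.  There the second factor is
  the rational function prod_j (1 - qzy_j/a)/(1 - qzy_j), and in its partial fraction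
  expansion the pole at z = 1/(qy_i) evaluates the first factor, a polynomial in 1/z, to s_mu at
  the point with y_i replaced by a y_i.  The residues are, up to a constant, the ratio of the
  Vandermonde determinants at the new and at the old point, so the bialternant formula leaves a
  sum over i of y_i^v times the alternant of mu + delta at the new point.  Expanding it by the
  Leibniz formula and collecting terms by columns instead of rows gives the alternants of
  mu + delta + v e_j, which is the right-hand side.
*)

theory Submission
  imports Defs "Jordan_Normal_Form.Char_Poly"
begin

text \<open>Symmetric functions are here polynomials in power sums over Q(q), a field that is not
  algebraically closed: prescribed power sums need not come from any point, so points detect zero
  only by a density argument. Distinct nonzero coordinates keep the poles simple and make the
  Vandermonde determinant invertible. The point with y_i replaced by a y_i may still have repeated
  coordinates, so the bialternant formula is always used multiplied out. \<open>schur\<close> is a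
  definite description; a determinant in complete homogeneous functions supplies its witness.
  Numerator and denominator of the rational function have the same degree in z, so the partial
  fractions contain a constant. The coefficient of z^v pairs a polynomial in 1/z only with
  coefficients of index at least v, so v > 0 keeps that constant out. The number n of variables may
  exceed |mu| + v: the surplus alternants have two equal columns, and the powers of q^u depending on
  n cancel, which leaves the exponent u p(mu)_i + v - ui.\<close>

section \<open>Homomorphisms out of the ring of symmetric functions\<close>

lemma sum_keys_superset:
  assumes "finite A" "Poly_Mapping.keys F \<subseteq> A" "c 0 = 0"
  shows "(\<Sum>m\<in>Poly_Mapping.keys F. c (Poly_Mapping.lookup F m) * w m) =
         (\<Sum>m\<in>A. c (Poly_Mapping.lookup F m) * (w m :: 'r :: comm_ring_1))"
  using assms by (intro sum.mono_neutral_left) (auto simp: in_keys_iff)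

definition monom_eval :: "(nat \<Rightarrow> 'r :: comm_ring_1) \<Rightarrow> (nat \<Rightarrow>\<^sub>0 nat) \<Rightarrow> 'r" where
  "monom_eval g m = (\<Prod>i\<in>Poly_Mapping.keys m. g (Suc i) ^ Poly_Mapping.lookup m i)"

lemma monom_eval_superset:
  assumes "finite A" "Poly_Mapping.keys m \<subseteq> A"
  shows "monom_eval g m = (\<Prod>i\<in>A. g (Suc i) ^ Poly_Mapping.lookup m i)"
  unfolding monom_eval_def using assms
  by (intro prod.mono_neutral_left) (auto simp: in_keys_iff)

lemma monom_eval_add: "monom_eval g (m + m') = monom_eval g m * monom_eval g m'"
proof -
  let ?A = "Poly_Mapping.keys m \<union> Poly_Mapping.keys m'"
  have "Poly_Mapping.keys (m + m') \<subseteq> ?A" by (rule Poly_Mapping.keys_add)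
  then show ?thesis
    by (simp add: monom_eval_superset[of ?A] lookup_add power_add prod.distrib)
qed

lemma monom_eval_0 [simp]: "monom_eval g 0 = 1"
  by (simp add: monom_eval_def)

lemma monom_eval_single [simp]: "monom_eval g (Poly_Mapping.single i k) = g (Suc i) ^ k"
  by (cases "k = 0") (simp_all add: monom_eval_def)

lemma subst_psum_monom_eval:
  "subst_psum c g F = (\<Sum>m\<in>Poly_Mapping.keys F. c (Poly_Mapping.lookup F m) * monom_eval g m)"
  by (simp add: subst_psum_def monom_eval_def)

lemma poly_mapping_sum_single:
  fixes F :: "'a \<Rightarrow>\<^sub>0 'b :: comm_monoid_add"
  shows "F = (\<Sum>m\<in>Poly_Mapping.keys F. Poly_Mapping.single m (Poly_Mapping.lookup F m))"
proof (rule poly_mapping_eqI)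
  fix k
  have "(\<Sum>m\<in>Poly_Mapping.keys F. Poly_Mapping.lookup (Poly_Mapping.single m (Poly_Mapping.lookup F m)) k)
      = (\<Sum>m\<in>Poly_Mapping.keys F. if m = k then Poly_Mapping.lookup F m else 0)"
    by (intro sum.cong) (auto simp: lookup_single when_def)
  also have "\<dots> = Poly_Mapping.lookup F k" by (simp add: in_keys_iff)
  finally show "Poly_Mapping.lookup F k = Poly_Mapping.lookup
      (\<Sum>m\<in>Poly_Mapping.keys F. Poly_Mapping.single m (Poly_Mapping.lookup F m)) k"
    by (simp add: lookup_sum)
qed

text \<open>One locale serves every scalar map that occurs: the embeddings into symmetric functions,
  Laurent series and polynomials, the identity for numerical evaluation, and the Adams operations,
  which are not linear over Q(q).\<close>

locale scalar_hom = comm_ring_hom hom for hom :: "qfield \<Rightarrow> 'r :: comm_ring_1"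
begin

lemma subst_psum_superset:
  assumes "finite A" "Poly_Mapping.keys F \<subseteq> A"
  shows "subst_psum hom g F = (\<Sum>m\<in>A. hom (Poly_Mapping.lookup F m) * monom_eval g m)"
  unfolding subst_psum_monom_eval by (rule sum_keys_superset) (use assms in auto)

lemma subst_psum_add: "subst_psum hom g (F + G) = subst_psum hom g F + subst_psum hom g G"
proof -
  let ?A = "Poly_Mapping.keys F \<union> Poly_Mapping.keys G"
  have "Poly_Mapping.keys (F + G) \<subseteq> ?A" by (rule Poly_Mapping.keys_add)
  then show ?thesis
    by (simp add: subst_psum_superset[of ?A] lookup_add hom_add algebra_simps sum.distrib)
qed

lemma subst_psum_zero: "subst_psum hom g 0 = 0"
  by (simp add: subst_psum_def)

lemma subst_psum_sum: "subst_psum hom g (sum f A) = (\<Sum>x\<in>A. subst_psum hom g (f x))"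
  by (induction A rule: infinite_finite_induct) (simp_all add: subst_psum_zero subst_psum_add)

lemma subst_psum_single:
  "subst_psum hom g (Poly_Mapping.single m c) = hom c * monom_eval g m"
  by (cases "c = 0") (simp_all add: subst_psum_monom_eval)

lemma subst_psum_mult: "subst_psum hom g (F * G) = subst_psum hom g F * subst_psum hom g G"
proof -
  have "F * G = (\<Sum>m\<in>Poly_Mapping.keys F. Poly_Mapping.single m (Poly_Mapping.lookup F m)) *
      (\<Sum>m\<in>Poly_Mapping.keys G. Poly_Mapping.single m (Poly_Mapping.lookup G m))"
    by (simp flip: poly_mapping_sum_single)
  also have "\<dots> = (\<Sum>m\<in>Poly_Mapping.keys F. \<Sum>m'\<in>Poly_Mapping.keys G.
      Poly_Mapping.single (m + m') (Poly_Mapping.lookup F m * Poly_Mapping.lookup G m'))"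
    by (simp add: sum_product mult_single)
  finally have "F * G = (\<Sum>m\<in>Poly_Mapping.keys F. \<Sum>m'\<in>Poly_Mapping.keys G.
      Poly_Mapping.single (m + m') (Poly_Mapping.lookup F m * Poly_Mapping.lookup G m'))" .
  then have "subst_psum hom g (F * G) = (\<Sum>m\<in>Poly_Mapping.keys F. \<Sum>m'\<in>Poly_Mapping.keys G.
      (hom (Poly_Mapping.lookup F m) * monom_eval g m) * 
      (hom (Poly_Mapping.lookup G m') * monom_eval g m'))"
    by (simp add: subst_psum_sum subst_psum_single monom_eval_add hom_mult mult_ac)
  then show ?thesis
    by (simp add: subst_psum_monom_eval sum_product)
qed

lemma subst_psum_scal [simp]: "subst_psum hom g (scal c) = hom c"
  by (simp add: scal_def subst_psum_single)

lemma subst_psum_var [simp]: "subst_psum hom g (var i) = g (Suc i)"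
  by (simp add: var_def subst_psum_single)

lemma subst_psum_psum [simp]: "k > 0 \<Longrightarrow> subst_psum hom g (psum k) = g k"
  by (simp add: psum_def)

lemma comm_ring_hom_subst_psum: "comm_ring_hom (subst_psum hom g)"
proof
  show "subst_psum hom g 1 = 1"
    using subst_psum_single[of g 0 1] by simp
qed (simp_all add: subst_psum_zero subst_psum_add subst_psum_mult)

end

interpretation scal: comm_ring_hom scal
  by unfold_locales (auto simp: scal_def single_add mult_single)

interpretation scal: scalar_hom scal ..

lemma comm_ring_hom_id: "comm_ring_hom (\<lambda>x. x :: 'r :: comm_ring_1)"
  by unfold_locales auto

lemma comm_ring_hom_comp:
  "comm_ring_hom f \<Longrightarrow> comm_ring_hom g \<Longrightarrow> comm_ring_hom (\<lambda>x. f (g x))"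
proof -
  assume "comm_ring_hom f" "comm_ring_hom g"
  then interpret f: comm_ring_hom f + g: comm_ring_hom g by simp_all
  show ?thesis by unfold_locales (auto simp: f.hom_add f.hom_mult g.hom_add g.hom_mult)
qed

lemma symfun_induct [case_names scal psum add mult]:
  fixes F :: symfun
  assumes s: "\<And>c. P (scal c)" and p: "\<And>k. k > 0 \<Longrightarrow> P (psum k)"
      and a: "\<And>F G. P F \<Longrightarrow> P G \<Longrightarrow> P (F + G)" and m: "\<And>F G. P F \<Longrightarrow> P G \<Longrightarrow> P (F * G)"
  shows "P F"
proof -
  have zero: "P 0" using s[of 0] by (simp add: scal_def)
  have one: "P 1" using s[of 1] by (simp add: scal_def)
  have pow: "P (G ^ k)" if "P G" for G :: symfun and k by (induction k) (auto simp: one m that)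
  have sing1: "P (Poly_Mapping.single (Poly_Mapping.single i k) 1)" for i k
  proof -
    have "Poly_Mapping.single (Poly_Mapping.single i k) (1 :: qfield) = var i ^ k"
    proof (induction k)
      case (Suc k)
      have "Poly_Mapping.single (Poly_Mapping.single i (Suc k)) (1 :: qfield) =
            Poly_Mapping.single (Poly_Mapping.single i 1 + Poly_Mapping.single i k) 1"
        by (simp flip: single_add)
      then show ?case
        unfolding power_Suc Suc.IH[symmetric] by (simp add: var_def mult_single)
    qed simp
    then show ?thesis using pow[OF p[of "Suc i"]] by (simp add: psum_def)
  qed
  have "P (Poly_Mapping.single (\<Sum>i\<in>A. Poly_Mapping.single i (f i)) 1)"
    if "finite A" for A :: "nat set" and f :: "nat \<Rightarrow> nat"
    using that
  proof induction
    case (insert i A)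
    have "Poly_Mapping.single (\<Sum>i\<in>insert i A. Poly_Mapping.single i (f i)) (1 :: qfield) =
        Poly_Mapping.single (Poly_Mapping.single i (f i)) 1 *
        Poly_Mapping.single (\<Sum>i\<in>A. Poly_Mapping.single i (f i)) 1"
      using insert by (simp add: mult_single)
    then show ?case using m[OF sing1 insert.IH] by simp
  qed (simp add: one)
  then have sing: "P (Poly_Mapping.single m 1)" for m :: "nat \<Rightarrow>\<^sub>0 nat"
    by (metis poly_mapping_sum_single finite_keys)
  have "P (Poly_Mapping.single m c)" for m c
    using m[OF s sing, of c m] by (simp add: scal_def mult_single)
  then have "P (\<Sum>m\<in>A. Poly_Mapping.single m (f m))" for A f
    by (induction A rule: infinite_finite_induct) (auto simp: zero a)
  then show ?thesis by (metis poly_mapping_sum_single)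
qed

text \<open>Uniqueness in the universal property of a polynomial ring. Most identities between
  substitutions below are reduced by it to scalars and power sums.\<close>

lemma symfun_hom_eqI:
  assumes "comm_ring_hom f" "comm_ring_hom g"
      and "\<And>c. f (scal c) = g (scal c)" "\<And>k. k > 0 \<Longrightarrow> f (psum k) = g (psum k)"
  shows "f F = g F"
proof -
  interpret f: comm_ring_hom f by fact
  interpret g: comm_ring_hom g by fact
  show ?thesis
    by (induction F rule: symfun_induct) (simp_all add: assms f.hom_add f.hom_mult g.hom_add g.hom_mult)
qed

section \<open>Adams operations on the field Q(q)\<close>

lemma pcompose_monom_eq_0_iff:
  fixes a :: "rat poly"
  assumes "k > 0"
  shows "pcompose a (monom 1 k) = 0 \<longleftrightarrow> a = 0"
  using pcompose_eq_0[of a "monom 1 k"] assms by (auto simp: degree_monom_eq)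

text \<open>\<open>adams_q\<close> is defined on the normalized fraction. The cross-multiplied
  equation between two representatives survives q -> q^k, and k > 0 keeps denominators nonzero, so
  any representative may be used.\<close>

lemma adams_q_Fract:
  assumes "k > 0" "b \<noteq> 0"
  shows "adams_q k (Fract a b) = Fract (pcompose a (monom 1 k)) (pcompose b (monom 1 k))"
proof -
  obtain a' b' where ab: "quot_of_fract (Fract a b) = (a', b')" by (cases "quot_of_fract (Fract a b)")
  have b': "b' \<noteq> 0" using snd_quot_of_fract_nonzero[of "Fract a b"] ab by simp
  have "Fract a' b' = Fract a b" using Fract_quot_of_fract[of "Fract a b"] ab by simp
  then have "a' * b = a * b'" using b' assms by (simp add: eq_fract)
  then have "pcompose (a' * b) (monom 1 k) = pcompose (a * b') (monom 1 k)" by simp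
  then show ?thesis
    using ab assms b' by (simp add: adams_q_def eq_fract pcompose_mult pcompose_monom_eq_0_iff)
qed

lemma comm_ring_hom_adams_q:
  assumes k: "k > 0"
  shows "comm_ring_hom (adams_q k)"
proof
  show "adams_q k 0 = 0" using adams_q_Fract[OF k, of 1 0] by (simp add: Zero_fract_def[symmetric] eq_fract fract_collapse)
  show "adams_q k 1 = 1" using adams_q_Fract[OF k, of 1 1] by (simp add: One_fract_def[symmetric])
  fix x y
  show "adams_q k (x + y) = adams_q k x + adams_q k y"
    by (cases x; cases y) (simp add: adams_q_Fract k pcompose_add pcompose_mult pcompose_monom_eq_0_iff)
  show "adams_q k (x * y) = adams_q k x * adams_q k y"
    by (cases x; cases y) (simp add: adams_q_Fract k pcompose_mult pcompose_monom_eq_0_iff)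
qed

lemma pcompose_X: "pcompose (monom 1 1) p = (p :: 'a :: comm_semiring_1 poly)"
  by (simp add: monom_altdef pcompose_pCons)

lemma adams_q_q:
  assumes "k > 0" shows "adams_q k q = q ^ k"
proof -
  have "q ^ k = Fract (monom 1 k) 1"
    by (induction k) (simp_all add: q_def One_fract_def mult_monom)
  then show ?thesis using assms
    by (simp add: q_def adams_q_Fract pcompose_X[simplified])
qed

lemma q_power_neq_1: "k > 0 \<Longrightarrow> q ^ k \<noteq> 1"
proof -
  assume "k > 0"
  have "q ^ k = Fract (monom 1 k) 1"
    by (induction k) (simp_all add: q_def One_fract_def mult_monom)
  moreover have "monom (1 :: rat) k \<noteq> 1"
    using \<open>k > 0\<close> by (simp add: monom_eq_1_iff)
  ultimately show ?thesis by (simp add: One_fract_def eq_fract)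
qed

lemma q_neq_0 [simp]: "q \<noteq> 0"
  by (simp add: q_def Zero_fract_def eq_fract)

section \<open>Evaluation in power sums detects zero\<close>

no_notation fps_nth (infixl "$" 75)


definition ev :: "(nat \<Rightarrow> qfield) \<Rightarrow> symfun \<Rightarrow> qfield" where
  "ev = subst_psum (\<lambda>c. c)"

lemma scalar_hom_ident: "scalar_hom (\<lambda>c. c)"
  by unfold_locales auto

interpretation ev: comm_ring_hom "ev w"
  unfolding ev_def by (rule scalar_hom.comm_ring_hom_subst_psum[OF scalar_hom_ident])

lemma ev_scal [simp]: "ev w (scal c) = c"
  by (simp add: ev_def scalar_hom.subst_psum_scal[OF scalar_hom_ident])

lemma ev_psum [simp]: "k > 0 \<Longrightarrow> ev w (psum k) = w k"
  by (simp add: ev_def scalar_hom.subst_psum_psum[OF scalar_hom_ident])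

lemma ev_var [simp]: "ev w (var i) = w (Suc i)"
  by (simp add: ev_def scalar_hom.subst_psum_var[OF scalar_hom_ident])

lemma ev_monom_eval: "ev w F = (\<Sum>m\<in>Poly_Mapping.keys F. Poly_Mapping.lookup F m * monom_eval w m)"
  by (simp add: ev_def subst_psum_monom_eval)

lemma const_poly_hom: "scalar_hom (\<lambda>c. [:c:])"
  by unfold_locales simp_all

text \<open>If the power sums move polynomially with a parameter, so does the value of F. Vanishing
  for infinitely many parameters then forces vanishing for all, which drives the density
  arguments.\<close>

lemma ev_line_poly:
  "\<exists>P. \<forall>c. poly P c = ev (\<lambda>k. poly (w k) c) F"
proof -
  interpret L: scalar_hom "\<lambda>c. [:c :: qfield:]" by (rule const_poly_hom)
  have "poly (subst_psum (\<lambda>c. [:c:]) w F) c = ev (\<lambda>k. poly (w k) c) F" for c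
    by (rule symfun_hom_eqI[where f = "\<lambda>F. poly (subst_psum (\<lambda>c. [:c:]) w F) c" and
          g = "ev (\<lambda>k. poly (w k) c)"])
       (simp_all add: ev.comm_ring_hom_axioms comm_ring_hom_comp[where f = "\<lambda>p. poly p c",
          OF poly_hom.comm_ring_hom_axioms L.comm_ring_hom_subst_psum])
  then show ?thesis by blast
qed

lemma digits_unique:
  fixes f g :: "nat \<Rightarrow> nat"
  assumes "\<And>i. f i < B" "\<And>i. g i < B" "(\<Sum>i<n. f i * B ^ i) = (\<Sum>i<n. g i * B ^ i)" "i < n"
  shows "f i = g i"
  using assms
proof (induction n arbitrary: f g i)
  case (Suc n)
  have B: "B > 0" using Suc.prems(1)[of 0] by simp
  have shift: "(\<Sum>i<Suc n. f i * B ^ i) = f 0 + B * (\<Sum>i<n. f (Suc i) * B ^ i)" for f :: "nat \<Rightarrow> nat"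
    by (subst sum.lessThan_Suc_shift) (simp add: sum_distrib_left mult_ac)
  have eq: "f 0 + B * (\<Sum>i<n. f (Suc i) * B ^ i) = g 0 + B * (\<Sum>i<n. g (Suc i) * B ^ i)"
    using Suc.prems(3) unfolding shift .
  then have "f 0 = g 0"
    using Suc.prems(1,2) by (metis mod_mult_self2 mod_less)
  moreover from this eq B have "(\<Sum>i<n. f (Suc i) * B ^ i) = (\<Sum>i<n. g (Suc i) * B ^ i)" by simp
  then have "f (Suc j) = g (Suc j)" if "j < n" for j
    using Suc.IH[of "\<lambda>i. f (Suc i)" "\<lambda>i. g (Suc i)" j] Suc.prems(1,2) that by blast
  ultimately show ?case using Suc.prems(4) by (cases i) auto
qed simp

text \<open>Kronecker substitution: with a base \<open>B\<close> exceeding all exponents, \<open>p\<^bsub>i+1\<^esub> \<mapsto> x\<^bsup>B\<^sup>i\<^esup>\<close> separates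
  the monomials of \<open>F\<close>.\<close>

lemma ev_all_zero_imp_zero:
  assumes ev0: "\<And>w. ev w F = 0"
  shows "F = 0"
proof (rule ccontr)
  assume "F \<noteq> 0"
  then obtain m0 where m0: "m0 \<in> Poly_Mapping.keys F" by (metis all_not_in_conv keys_eq_empty)
  define V where "V = (\<Union>m\<in>Poly_Mapping.keys F. Poly_Mapping.keys m)"
  define N where "N = Suc (Max (insert 0 V))"
  define B where "B = Suc (Max (insert 0 (\<Union>m\<in>Poly_Mapping.keys F. Poly_Mapping.lookup m ` V)))"
  have finV: "finite V" by (simp add: V_def)
  have V: "Poly_Mapping.keys m \<subseteq> {..<N}" if "m \<in> Poly_Mapping.keys F" for m
  proof
    fix i assume "i \<in> Poly_Mapping.keys m"
    then have "i \<in> V" using that by (auto simp: V_def)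
    then have "i \<le> Max (insert 0 V)" using finV by simp
    then show "i \<in> {..<N}" by (simp add: N_def)
  qed
  have B: "Poly_Mapping.lookup m i < B" if "m \<in> Poly_Mapping.keys F" for m i
  proof (cases "i \<in> V")
    case True
    then have "Poly_Mapping.lookup m i \<le> Max (insert 0 (\<Union>m\<in>Poly_Mapping.keys F. Poly_Mapping.lookup m ` V))"
      using that finV by (intro Max_ge) auto
    then show ?thesis by (simp add: B_def)
  next
    case False
    then have "Poly_Mapping.lookup m i = 0" using that by (auto simp: V_def in_keys_iff)
    then show ?thesis by (simp add: B_def)
  qed
  define e where "e m = (\<Sum>i<N. Poly_Mapping.lookup m i * B ^ i)" for m :: "nat \<Rightarrow>\<^sub>0 nat"
  have inj: "m = m0" if "m \<in> Poly_Mapping.keys F" "e m = e m0" for m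
  proof (rule poly_mapping_eqI)
    fix i
    show "Poly_Mapping.lookup m i = Poly_Mapping.lookup m0 i"
    proof (cases "i < N")
      case True
      then show ?thesis
        using digits_unique[of "Poly_Mapping.lookup m" B "Poly_Mapping.lookup m0" N i]
          B that m0 by (simp add: e_def)
    next
      case False
      then have "i \<notin> Poly_Mapping.keys m" "i \<notin> Poly_Mapping.keys m0" using V that m0 by blast+
      then show ?thesis by (simp add: in_keys_iff)
    qed
  qed
  define P where "P = (\<Sum>m\<in>Poly_Mapping.keys F. monom (Poly_Mapping.lookup F m) (e m))"
  have "poly P c = 0" for c
  proof -
    have "monom_eval (\<lambda>k. c ^ (B ^ (k - 1))) m = c ^ e m" if "m \<in> Poly_Mapping.keys F" for m
      using monom_eval_superset[of "{..<N}" m "\<lambda>k. c ^ (B ^ (k - 1))"] V[OF that]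
      by (simp add: e_def power_sum mult.commute flip: power_mult)
    then have "poly P c = ev (\<lambda>k. c ^ (B ^ (k - 1))) F"
      by (simp add: P_def poly_sum poly_monom ev_monom_eval)
    then show ?thesis by (simp add: ev0)
  qed
  then have "P = 0" by (metis poly_all_0_iff_0)
  then have "coeff P (e m0) = 0" by simp
  moreover have "coeff P (e m0) = (\<Sum>m\<in>Poly_Mapping.keys F. if m = m0 then Poly_Mapping.lookup F m else 0)"
    unfolding P_def coeff_sum by (intro sum.cong) (auto simp: inj)
  ultimately show False using m0 by (simp add: in_keys_iff)
qed

lemma ev_cong:
  assumes "\<And>k. k \<ge> 1 \<Longrightarrow> k \<le> m \<Longrightarrow> w k = w' k"
    and "\<And>M. M \<in> Poly_Mapping.keys F \<Longrightarrow> Poly_Mapping.keys M \<subseteq> {..<m}"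
  shows "ev w F = ev w' F"
  unfolding ev_monom_eval
proof (intro sum.cong refl arg_cong2[of _ _ _ _ "(*)"])
  fix M assume "M \<in> Poly_Mapping.keys F"
  then have "i < m" if "i \<in> Poly_Mapping.keys M" for i using assms(2) that by blast
  then show "monom_eval w M = monom_eval w' M"
    unfolding monom_eval_def using assms(1) by (intro prod.cong refl) (simp add: Suc_le_eq)
qed

definition pow_sums :: "nat \<Rightarrow> (nat \<Rightarrow> 'r) \<Rightarrow> nat \<Rightarrow> 'r :: comm_ring_1" where
  "pow_sums n y k = (\<Sum>i<n. y i ^ k)"

text \<open>The degree bound is expressed by coefficients, so that it is also meaningful for n = 0,
  where it forces P to vanish.\<close>

lemma poly_eq_0_if_roots:
  fixes P :: "'a :: idom poly"
  assumes "inj_on y {..<n}" "\<And>k. k \<ge> n \<Longrightarrow> coeff P k = 0" "\<And>i. i < n \<Longrightarrow> poly P (y i) = 0"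
  shows "P = 0"
proof (rule ccontr)
  assume "P \<noteq> 0"
  have "y ` {..<n} \<subseteq> {x. poly P x = 0}" using assms(3) by auto
  then have "card (y ` {..<n}) \<le> card {x. poly P x = 0}"
    using poly_roots_finite[OF \<open>P \<noteq> 0\<close>] by (rule card_mono[rotated])
  also have "\<dots> \<le> degree P" by (rule card_poly_roots_bound[OF \<open>P \<noteq> 0\<close>])
  finally have "n \<le> degree P" using assms(1) by (simp add: card_image)
  then show False using \<open>P \<noteq> 0\<close> assms(2) by (metis leading_coeff_0_iff)
qed

text \<open>A kernel vector is the coefficient list of a polynomial of degree below n that vanishes
  at the n distinct nodes.\<close>

lemma det_vandermonde_neq_0:
  fixes y :: "nat \<Rightarrow> 'a :: field"
  assumes "inj_on y {..<n}"
  shows "det (mat n n (\<lambda>(i, j). y i ^ (n - 1 - j))) \<noteq> 0"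
proof
  let ?A = "mat n n (\<lambda>(i, j). y i ^ (n - 1 - j))"
  assume "det ?A = 0"
  then obtain v where v: "v \<in> carrier_vec n" "v \<noteq> 0\<^sub>v n" "?A *\<^sub>v v = 0\<^sub>v n"
    using det_0_iff_vec_prod_zero_field[of ?A n] by auto
  define P where "P = (\<Sum>j<n. monom (v $ j) (n - 1 - j))"
  have roots: "poly P (y i) = 0" if "i < n" for i
  proof -
    have "(?A *\<^sub>v v) $ i = (\<Sum>j<n. y i ^ (n - 1 - j) * v $ j)"
      using that v(1) by (simp add: scalar_prod_def atLeast0LessThan)
    moreover have "(?A *\<^sub>v v) $ i = 0" unfolding v(3) using that by simp
    ultimately show ?thesis by (simp add: P_def poly_sum poly_monom mult.commute)
  qed
  have coeffs: "coeff P (n - 1 - j) = v $ j" if "j < n" for j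
  proof -
    have "coeff P (n - 1 - j) = (\<Sum>i<n. if i = j then v $ i else 0)"
      unfolding P_def coeff_sum using that by (intro sum.cong) auto
    then show ?thesis using that by simp
  qed
  have "coeff P k = 0" if "k \<ge> n" for k
    unfolding P_def coeff_sum using that by (intro sum.neutral) auto
  then have "P = 0" using poly_eq_0_if_roots[OF assms] roots by blast
  then have "v = 0\<^sub>v n" using coeffs v(1) by (intro eq_vecI) auto
  then show False using v(2) by simp
qed

text \<open>Weights replace the roots that Q(q) may lack: arbitrary values of the first m power sums
  are attained by weighted points at the nodes 1, ..., m. Since F involves finitely many power sums,
  these suffice.\<close>

lemma vandermonde_spans:
  fixes w :: "nat \<Rightarrow> 'a :: field_char_0"
  shows "\<exists>c. \<forall>k. 1 \<le> k \<longrightarrow> k \<le> m \<longrightarrow> (\<Sum>l<m. c l * of_nat (Suc l) ^ k) = w k"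
proof -
  define y where "y l = (of_nat (Suc l) :: 'a)" for l
  define A where "A = mat m m (\<lambda>(i, j). y i ^ (m - 1 - j))"
  have A: "A \<in> carrier_mat m m" by (simp add: A_def)
  have "inj_on y {..<m}" by (auto simp: y_def inj_on_def simp del: of_nat_Suc)
  then have "det A \<noteq> 0" unfolding A_def by (rule det_vandermonde_neq_0)
  then obtain B where B: "B \<in> carrier_mat m m" "B * A = 1\<^sub>m m"
    using det_non_zero_imp_unit[OF A] by (auto simp: Units_def ring_mat_def)
  \<comment> \<open>Column j of \<open>A\<close> carries the exponent m - 1 - j, hence the reversed
    index. The exponents wanted run from 1 to m, not from 0 to m - 1; dividing by \<open>y l\<close>
    in the weight makes up for the extra factor.\<close>
  define u where "u = vec m (\<lambda>j. w (m - j))"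
  define c where "c l = (\<Sum>j<m. u $ j * B $$ (j, l)) / y l" for l
  have "(\<Sum>l<m. c l * y l ^ k) = w k" if "1 \<le> k" "k \<le> m" for k
  proof -
    define j where "j = m - k"
    have j: "j < m" "m - j = k" "m - 1 - j = k - 1" using that by (auto simp: j_def)
    have "(\<Sum>l<m. c l * y l ^ k) = (\<Sum>l<m. (\<Sum>i<m. u $ i * B $$ (i, l)) * y l ^ (k - 1))"
    proof (intro sum.cong refl)
      fix l
      have "y l \<noteq> 0" by (simp add: y_def del: of_nat_Suc)
      then show "c l * y l ^ k = (\<Sum>i<m. u $ i * B $$ (i, l)) * y l ^ (k - 1)"
        using that by (cases k) (auto simp: c_def)
    qed
    also have "\<dots> = (\<Sum>i<m. u $ i * (\<Sum>l<m. B $$ (i, l) * y l ^ (k - 1)))"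
      by (simp add: sum_distrib_right sum_distrib_left mult.assoc) (rule sum.swap)
    also have "\<dots> = (\<Sum>i<m. u $ i * (B * A) $$ (i, j))"
      using B(1) A j by (intro sum.cong refl) 
        (auto simp: scalar_prod_def A_def atLeast0LessThan intro!: sum.cong)
    also have "\<dots> = (\<Sum>i<m. if i = j then u $ i else 0)"
      using j by (intro sum.cong) (auto simp: B(2))
    also have "\<dots> = w k" using j by (simp add: u_def)
    finally show ?thesis .
  qed
  then show ?thesis unfolding y_def by blast
qed

lemma infinite_nats_fract: "infinite (range (of_nat :: nat \<Rightarrow> 'a :: ring_char_0))"
  by (simp add: finite_image_iff inj_on_def)

lemma poly_eq_0_if_infinite_roots:
  fixes P :: "'a :: idom poly"
  assumes "S \<subseteq> {c. poly P c = 0}" "infinite S"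
  shows "P = 0"
  using assms by (metis poly_roots_finite finite_subset)

text \<open>Moving y along the direction (1, ..., n) makes its coordinates distinct and nonzero for
  all but finitely many parameters; the polynomial in the parameter is then zero, also at parameter
  0.\<close>

lemma ev_pow_sums_nongeneric:
  assumes "\<And>y. inj_on y {..<n} \<Longrightarrow> (\<forall>i<n. y i \<noteq> 0) \<Longrightarrow> ev (pow_sums n y) F = 0"
  shows "ev (pow_sums n y) F = 0"
proof -
  define z where "z c i = y i + c * of_nat (Suc i)" for c i
  obtain P where P: "\<And>c. poly P c = ev (\<lambda>k. poly (\<Sum>i<n. [:y i, of_nat (Suc i):] ^ k) c) F"
    using ev_line_poly[of "\<lambda>k. \<Sum>i<n. [:y i, of_nat (Suc i):] ^ k" F] by auto
  have Pz: "poly P c = ev (pow_sums n (z c)) F" for c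
    by (simp add: P pow_sums_def[abs_def] z_def poly_sum)
  \<comment> \<open>The parameters at which a coordinate vanishes or two coordinates collide. The
    pairs with i = j contribute 0/0 = 0, a harmless extra element.\<close>
  define Bad where "Bad = (\<lambda>i. - y i / of_nat (Suc i)) ` {..<n} \<union>
    (\<lambda>(i, j). (y j - y i) / (of_nat (Suc i) - of_nat (Suc j))) ` ({..<n} \<times> {..<n})"
  have "poly P c = 0" if "c \<notin> Bad" for c
    unfolding Pz
  proof (rule assms)
    show "\<forall>i<n. z c i \<noteq> 0"
    proof (intro allI impI notI)
      fix i assume "i < n" "z c i = 0"
      then have "c * of_nat (Suc i) = - y i" by (simp add: z_def add_eq_0_iff del: of_nat_Suc)
      then have "c = - y i / of_nat (Suc i)"
        using nonzero_mult_div_cancel_right[OF of_nat_neq_0, of c i] by (simp only:)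
      then show False using that \<open>i < n\<close> by (auto simp: Bad_def)
    qed
    show "inj_on (z c) {..<n}"
    proof (rule inj_onI, rule ccontr)
      fix i j assume ij: "i \<in> {..<n}" "j \<in> {..<n}" "z c i = z c j" "i \<noteq> j"
      then have "c * (of_nat (Suc i) - of_nat (Suc j)) = y j - y i"
        by (simp add: z_def algebra_simps)
      then have "c = (y j - y i) / (of_nat (Suc i) - of_nat (Suc j))"
        using ij(4) nonzero_mult_div_cancel_right[of "of_nat (Suc i) - of_nat (Suc j) :: qfield" c]
        by (simp del: of_nat_Suc)
      then show False using that ij(1,2) by (auto simp: Bad_def)
    qed
  qed
  then have "- Bad \<subseteq> {c. poly P c = 0}" by auto
  moreover have "infinite (- Bad)"
  proof -
    have "infinite (UNIV :: qfield set)"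
      by (rule infinite_super[OF subset_UNIV infinite_nats_fract])
    moreover have "finite Bad" by (simp add: Bad_def)
    ultimately show ?thesis by (simp add: Compl_eq_Diff_UNIV)
  qed
  ultimately have "P = 0" by (rule poly_eq_0_if_infinite_roots)
  moreover have "z 0 = y" by (simp add: z_def fun_eq_iff)
  ultimately show ?thesis using Pz[of 0] by simp
qed

text \<open>Repeating a node x exactly r times adds r x^k to the power sums. The value of F is
  polynomial in r and vanishes at all naturals, so the multiplicity r may become any scalar;
  weighted points then reach all values of the power sums in F.\<close>

theorem ev_pow_sums_eq_0_imp_eq_0:
  assumes "\<And>n y. n \<ge> N \<Longrightarrow> inj_on y {..<n} \<Longrightarrow> (\<forall>i<n. y i \<noteq> 0) \<Longrightarrow> ev (pow_sums n y) F = 0"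
  shows "F = 0"
proof (rule ev_all_zero_imp_zero)
  fix w :: "nat \<Rightarrow> qfield"
  have big: "ev (pow_sums n y) F = 0" if "n \<ge> N" for n y
    by (rule ev_pow_sums_nongeneric, rule assms) (simp_all add: that)
  \<comment> \<open>Padding with zero coordinates leaves every p_k with k > 0 unchanged and removes
    the bound \<open>N\<close>.\<close>
  have all: "ev (pow_sums n y) F = 0" for n y
  proof -
    define z where "z i = (if i < n then y i else 0)" for i
    have "pow_sums (n + N) z k = pow_sums n y k" if "k > 0" for k
    proof -
      have "pow_sums (n + N) z k = (\<Sum>i<n. z i ^ k)"
        unfolding pow_sums_def using that by (intro sum.mono_neutral_right) (auto simp: z_def)
      then show ?thesis by (simp add: z_def pow_sums_def)
    qed
    then have "ev (pow_sums (n + N) z) F = ev (pow_sums n y) F"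
      using symfun_hom_eqI[of "ev (pow_sums (n + N) z)" "ev (pow_sums n y)" F]
      by (simp add: ev.comm_ring_hom_axioms)
    then show ?thesis using big[of "n + N" z] by simp
  qed
  \<comment> \<open>The arbitrary additional points in \<open>S\<close> make the induction work:
    they absorb the r copies of a new node, so weighted nodes can be added one at a time.\<close>
  define S where "S = {w. \<forall>n y. ev (\<lambda>k. w k + pow_sums n y k) F = 0}"
  have step: "(\<lambda>k. w k + c * x ^ k) \<in> S" if "w \<in> S" for w c x
    unfolding S_def
  proof (intro CollectI allI)
    fix n y
    obtain P where P: "\<And>c. poly P c = ev (\<lambda>k. poly [:w k + pow_sums n y k, x ^ k:] c) F"
      using ev_line_poly[of "\<lambda>k. [:w k + pow_sums n y k, x ^ k:]" F] by auto
    have "poly P (of_nat r) = 0" for r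
    proof -
      define z where "z i = (if i < n then y i else x)" for i
      have "pow_sums (n + r) z k = pow_sums n y k + of_nat r * x ^ k" for k
      proof (induction r)
        case 0 then show ?case by (simp add: pow_sums_def z_def)
      next
        case (Suc r) then show ?case by (simp add: pow_sums_def z_def algebra_simps)
      qed
      then have "poly P (of_nat r) = ev (\<lambda>k. w k + pow_sums (n + r) z k) F"
        by (simp add: P add.assoc)
      then show ?thesis using \<open>w \<in> S\<close> by (simp add: S_def)
    qed
    then have "range of_nat \<subseteq> {c. poly P c = 0}" by auto
    then have "P = 0" by (rule poly_eq_0_if_infinite_roots) (rule infinite_nats_fract)
    then show "ev (\<lambda>k. w k + c * x ^ k + pow_sums n y k) F = 0"
      using P[of c] by (simp add: add_ac)
  qed
  have span: "(\<lambda>k. \<Sum>l<m. c l * x l ^ k) \<in> S" for m :: nat and c x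
  proof (induction m)
    case 0 then show ?case using all by (simp add: S_def)
  next
    case (Suc m) then show ?case using step[OF Suc, of "c m" "x m"] by simp
  qed
  define V where "V = (\<Union>m\<in>Poly_Mapping.keys F. Poly_Mapping.keys m)"
  define m where "m = Suc (Max (insert 0 V))"
  have m: "Poly_Mapping.keys M \<subseteq> {..<m}" if "M \<in> Poly_Mapping.keys F" for M
  proof
    fix i assume "i \<in> Poly_Mapping.keys M"
    then have "i \<in> V" using that by (auto simp: V_def)
    then have "i \<le> Max (insert 0 V)" by (simp add: V_def)
    then show "i \<in> {..<m}" by (simp add: m_def)
  qed
  obtain c where c: "\<And>k. 1 \<le> k \<Longrightarrow> k \<le> m \<Longrightarrow> (\<Sum>l<m. c l * of_nat (Suc l) ^ k) = w k"
    using vandermonde_spans[of m w] by auto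
  have "ev w F = ev (\<lambda>k. (\<Sum>l<m. c l * of_nat (Suc l) ^ k) + pow_sums 0 (\<lambda>_. 0) k) F"
    using m by (intro ev_cong[of m]) (simp_all add: c pow_sums_def del: of_nat_Suc)
  also have "\<dots> = 0" using span[where m = m and c = c and x = "\<lambda>l. of_nat (Suc l)"] by (simp add: S_def)
  finally show "ev w F = 0" .
qed

section \<open>Power series with prescribed power sums\<close>

definition geo :: "'a :: comm_ring_1 \<Rightarrow> 'a fps" where
  "geo x = Abs_fps (\<lambda>k. x ^ k)"

definition root_prod :: "nat \<Rightarrow> (nat \<Rightarrow> 'a :: comm_ring_1) \<Rightarrow> 'a fps" where
  "root_prod n x = (\<Prod>i<n. 1 - fps_const (x i) * fps_X)"

lemma geo_mult: "geo x * (1 - fps_const x * fps_X) = 1"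
proof -
  have "geo x * (1 - fps_const x * fps_X) = geo x - fps_const x * (geo x * fps_X)"
    by (simp add: algebra_simps)
  also have "\<dots> = 1"
    by (rule fps_ext) (simp add: geo_def power_eq_if)
  finally show ?thesis .
qed

text \<open>The logarithmic derivative of 1 - xz is -x/(1 - xz), written without division.\<close>

lemma deriv_mult_linear_factor:
  fixes E :: "'a :: comm_ring_1 fps"
  assumes "fps_deriv E = Q * E"
  shows "fps_deriv (E * (1 - fps_const x * fps_X)) =
         (Q - fps_const x * geo x) * (E * (1 - fps_const x * fps_X))"
proof -
  let ?L = "1 - fps_const x * fps_X"
  have "(Q - fps_const x * geo x) * (E * ?L) = Q * E * ?L - fps_const x * E * (geo x * ?L)"
    by (simp add: algebra_simps)
  also have "\<dots> = Q * E * ?L - fps_const x * E"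
    by (simp only: geo_mult mult_1_right)
  finally show ?thesis
    by (simp add: assms algebra_simps)
qed

lemma deriv_mult_root_prod:
  fixes E :: "'a :: comm_ring_1 fps"
  assumes "fps_deriv E = Q * E"
  shows "fps_deriv (E * root_prod n x) = (Q - (\<Sum>i<n. fps_const (x i) * geo (x i))) * (E * root_prod n x)"
proof (induction n)
  case 0
  then show ?case using assms by (simp add: root_prod_def)
next
  case (Suc n)
  have "E * root_prod (Suc n) x = (E * root_prod n x) * (1 - fps_const (x n) * fps_X)"
    by (simp add: root_prod_def mult_ac)
  then show ?case using deriv_mult_linear_factor[OF Suc, of "x n"] by (simp add: diff_diff_eq)
qed

lemma fps_linear_ode_unique:
  fixes F G :: "'a :: field_char_0 fps"
  assumes F: "fps_deriv F = Q * F" and G: "fps_deriv G = Q * G" and 0: "fps_nth F 0 = fps_nth G 0"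
  shows "F = G"
proof (rule fps_ext)
  fix n show "fps_nth F n = fps_nth G n"
  proof (induction n rule: less_induct)
    case (less n)
    show ?case
    proof (cases n)
      case (Suc m)
      have "fps_nth (fps_deriv F) m = fps_nth (fps_deriv G) m"
        unfolding F G fps_mult_nth using less Suc by (intro sum.cong) auto
      then show ?thesis using Suc by (simp del: of_nat_Suc)
    qed (simp add: 0)
  qed
qed

text \<open>The recurrence says that the logarithmic derivative of E generates the differences of
  power sums, as it does for the quotient of \<open>root_prod n b\<close> by
  \<open>root_prod n x\<close>; in characteristic 0 this and the constant term determine the series.
  It serves both for the complete homogeneous functions and for \<open>Omega\<close>.\<close>

lemma fps_exp_power_sums:
  fixes E :: "'a :: field_char_0 fps"
  assumes E0: "fps_nth E 0 = 1"
    and rec: "\<And>m. of_nat (Suc m) * fps_nth E (Suc m) =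
      (\<Sum>k\<le>m. (pow_sums n x (Suc k) - pow_sums n b (Suc k)) * fps_nth E (m - k))"
  shows "E * root_prod n x = root_prod n b"
proof -
  define Q where "Q y = (\<Sum>i<n. fps_const (y i) * geo (y i))" for y :: "nat \<Rightarrow> 'a"
  have Q: "fps_nth (Q y) k = pow_sums n y (Suc k)" for y k
    by (simp add: Q_def fps_sum_nth geo_def pow_sums_def)
  have "fps_deriv E = (Q x - Q b) * E"
  proof (rule fps_ext)
    fix m
    show "fps_nth (fps_deriv E) m = fps_nth ((Q x - Q b) * E) m"
      using rec[of m] by (simp add: fps_mult_nth Q atLeast0AtMost del: of_nat_Suc)
  qed
  then have 1: "fps_deriv (E * root_prod n x) = (- Q b) * (E * root_prod n x)"
    using deriv_mult_root_prod[of E "Q x - Q b" n x] by (simp add: Q_def)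
  have 2: "fps_deriv (root_prod n b) = (- Q b) * root_prod n b"
    using deriv_mult_root_prod[of 1 0 n b] by (simp add: Q_def)
  have root0: "fps_nth (root_prod n y) 0 = 1" for y :: "nat \<Rightarrow> 'a"
    by (induction n) (simp_all add: root_prod_def)
  show ?thesis
    by (rule fps_linear_ode_unique[OF 1 2]) (simp add: root0 E0)
qed

section \<open>Schur functions and alternants\<close>

text \<open>The complete homogeneous symmetric functions, defined by Newton's recurrence so that
  they are polynomials in power sums from the start.\<close>

fun hsym :: "nat \<Rightarrow> symfun" where
  "hsym 0 = 1"
| "hsym (Suc n) = scal (1 / of_nat (Suc n)) * (\<Sum>k\<le>n. psum (Suc k) * hsym (n - k))"

definition h_int :: "int \<Rightarrow> symfun" where
  "h_int i = (if i < 0 then 0 else hsym (nat i))"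

lemma pow_sums_0 [simp]: "pow_sums n (\<lambda>_. 0) (Suc k) = 0"
  by (simp add: pow_sums_def)

lemma hsym_generating_function:
  "Abs_fps (\<lambda>m. ev (pow_sums n y) (hsym m)) * root_prod n y = 1"
proof -
  \<comment> \<open>An alphabet of n zeros has vanishing power sums and turns the right-hand side
    into 1.\<close>
  have "Abs_fps (\<lambda>m. ev (pow_sums n y) (hsym m)) * root_prod n y = root_prod n (\<lambda>_. 0)"
  proof (rule fps_exp_power_sums)
    fix m
    have "of_nat (Suc m) * ev (pow_sums n y) (hsym (Suc m)) =
      (of_nat (Suc m) * (1 / of_nat (Suc m))) *
      (\<Sum>k\<le>m. pow_sums n y (Suc k) * ev (pow_sums n y) (hsym (m - k)))"
      by (simp add: ev.hom_mult ev.hom_sum mult.assoc del: of_nat_Suc)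
    also have "of_nat (Suc m) * (1 / of_nat (Suc m)) = (1 :: qfield)"
      by (simp del: of_nat_Suc)
    finally show "of_nat (Suc m) * fps_nth (Abs_fps (\<lambda>m. ev (pow_sums n y) (hsym m))) (Suc m) =
      (\<Sum>k\<le>m. (pow_sums n y (Suc k) - pow_sums n (\<lambda>_. 0) (Suc k)) *
         fps_nth (Abs_fps (\<lambda>m. ev (pow_sums n y) (hsym m))) (m - k))"
      by (simp del: of_nat_Suc)
  qed simp
  then show ?thesis by (simp add: root_prod_def)
qed

lemma fps_nth_root_prod_eq_0:
  assumes "finite A" "k > card A"
  shows "fps_nth (\<Prod>j\<in>A. 1 - fps_const (y j) * fps_X) k = (0 :: 'a :: comm_ring_1)"
  using assms
proof (induction A arbitrary: k rule: finite_induct)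
  case (insert i A)
  let ?P = "\<Prod>j\<in>A. 1 - fps_const (y j) * fps_X"
  have "(\<Prod>j\<in>insert i A. 1 - fps_const (y j) * fps_X) = ?P - fps_const (y i) * (?P * fps_X)"
    using insert by (simp add: algebra_simps)
  moreover have "fps_nth ?P k = 0" "fps_nth ?P (k - 1) = 0"
    using insert by (auto intro!: insert.IH)
  ultimately show ?case by simp
qed simp

definition co_root_prod :: "nat \<Rightarrow> (nat \<Rightarrow> 'a :: comm_ring_1) \<Rightarrow> nat \<Rightarrow> 'a fps" where
  "co_root_prod n y i = (\<Prod>j\<in>{..<n} - {i}. 1 - fps_const (y j) * fps_X)"

lemma geo_eq_hsym_mult:
  assumes "i < n"
  shows "geo (y i) = co_root_prod n y i * Abs_fps (\<lambda>m. ev (pow_sums n y) (hsym m))"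
proof -
  let ?L = "1 - fps_const (y i) * fps_X" and ?H = "Abs_fps (\<lambda>m. ev (pow_sums n y) (hsym m))"
  have "root_prod n y = ?L * co_root_prod n y i"
    unfolding root_prod_def co_root_prod_def using assms by (simp add: prod.remove)
  then have "geo (y i) * (?H * (?L * co_root_prod n y i)) = geo (y i)"
    using hsym_generating_function[of n y] by simp
  then have "(geo (y i) * ?L) * (co_root_prod n y i * ?H) = geo (y i)"
    by (simp only: mult_ac)
  then show ?thesis by (simp only: geo_mult mult_1_left)
qed

text \<open>The coefficients of \<open>co_root_prod\<close> vanish from index n on and
  \<open>h_int\<close> vanishes at negative arguments, so the convolution can run over j < n
  whatever the exponent a is. This fixed range lets it be read as a matrix product.\<close>

lemma power_eq_hsym_sum:
  assumes "i < n"
  shows "y i ^ a = (\<Sum>j<n. fps_nth (co_root_prod n y i) j * ev (pow_sums n y) (h_int (int a - int j)))"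
proof -
  let ?c = "\<lambda>j. fps_nth (co_root_prod n y i) j"
  have "y i ^ a = fps_nth (geo (y i)) a" by (simp add: geo_def)
  also have "\<dots> = (\<Sum>j=0..a. ?c j * ev (pow_sums n y) (hsym (a - j)))"
    by (simp add: geo_eq_hsym_mult[OF assms] fps_mult_nth)
  also have "\<dots> = (\<Sum>j=0..a. ?c j * ev (pow_sums n y) (h_int (int a - int j)))"
    by (intro sum.cong) (auto simp: h_int_def nat_diff_distrib)
  also have "\<dots> = (\<Sum>j\<in>{0..a} \<union> {..<n}. ?c j * ev (pow_sums n y) (h_int (int a - int j)))"
    by (intro sum.mono_neutral_left) (auto simp: h_int_def)
  also have "\<dots> = (\<Sum>j<n. ?c j * ev (pow_sums n y) (h_int (int a - int j)))"
  proof (intro sum.mono_neutral_right ballI)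
    fix j assume "j \<in> {0..a} \<union> {..<n} - {..<n}"
    then have "?c j = 0" using assms
      unfolding co_root_prod_def by (intro fps_nth_root_prod_eq_0) auto
    then show "?c j * ev (pow_sums n y) (h_int (int a - int j)) = 0" by simp
  qed auto
  finally show ?thesis .
qed

definition alternant_at :: "nat \<Rightarrow> (nat \<Rightarrow> 'a :: comm_ring_1) \<Rightarrow> (nat \<Rightarrow> nat) \<Rightarrow> 'a" where
  "alternant_at n y a = det (mat n n (\<lambda>(i, j). y i ^ a j))"

text \<open>With b_k = lambda_k - k this is the Jacobi-Trudi determinant, the parts labelling
  columns.\<close>

definition h_det :: "nat \<Rightarrow> (nat \<Rightarrow> int) \<Rightarrow> symfun" where
  "h_det n b = det (mat n n (\<lambda>(j, k). h_int (b k + int j)))"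

lemma ev_h_det: "ev w (h_det n b) = det (mat n n (\<lambda>(j, k). ev w (h_int (b k + int j))))"
proof -
  have "map_mat (ev w) (mat n n (\<lambda>(j, k). h_int (b k + int j))) = mat n n (\<lambda>(j, k). ev w (h_int (b k + int j)))"
    by (rule eq_matI) auto
  then show ?thesis by (simp add: h_det_def flip: ev.hom_det)
qed

text \<open>Jacobi--Trudi: row \<open>i\<close> of the alternant is the expansion of \<open>1/(1 - y\<^sub>i z)\<close> as the product
  of the generating function of the \<open>h\<^sub>m\<close> and \<open>\<Prod>\<^sub>j\<^sub>\<noteq>\<^sub>i (1 - y\<^sub>j z)\<close>, so that the alternant matrix
  is a product with one factor independent of the exponents.\<close>

lemma jacobi_trudi:
  fixes y :: "nat \<Rightarrow> qfield"
  shows "ev (pow_sums n y) (h_det n (\<lambda>k. int (a k) - int (n - 1))) * alternant_at n y (\<lambda>j. n - 1 - j) =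
         alternant_at n y a"
proof -
  let ?h = "\<lambda>i. ev (pow_sums n y) (h_int i)"
  define E where "E = mat n n (\<lambda>(i, j). fps_nth (co_root_prod n y i) (n - 1 - j))"
  define H where "H a = mat n n (\<lambda>(j, k). ?h (int (a k) - int (n - 1) + int j))" for a
  have carr: "E \<in> carrier_mat n n" "H a \<in> carrier_mat n n" for a by (simp_all add: E_def H_def)
  have "mat n n (\<lambda>(i, j). y i ^ a j) = E * H a" for a
  proof (rule eq_matI)
    fix i k assume "i < dim_row (E * H a)" "k < dim_col (E * H a)"
    then have ik: "i < n" "k < n" by (simp_all add: E_def H_def)
    have "(E * H a) $$ (i, k) =
       (\<Sum>j<n. fps_nth (co_root_prod n y i) (n - 1 - j) * ?h (int (a k) - int (n - 1) + int j))"
      using ik by (simp add: E_def H_def scalar_prod_def atLeast0LessThan)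
    also have "\<dots> = (\<Sum>j<n. fps_nth (co_root_prod n y i) (n - Suc j) * ?h (int (a k) - int (n - Suc j)))"
    proof (intro sum.cong refl)
      fix j assume "j \<in> {..<n}"
      then have "int (a k) - int (n - 1) + int j = int (a k) - int (n - Suc j)" by auto
      then show "fps_nth (co_root_prod n y i) (n - 1 - j) * ?h (int (a k) - int (n - 1) + int j) =
        fps_nth (co_root_prod n y i) (n - Suc j) * ?h (int (a k) - int (n - Suc j))"
        by (simp only: One_nat_def diff_diff_left add_Suc add_0)
    qed
    also have "\<dots> = (\<Sum>j<n. fps_nth (co_root_prod n y i) j * ?h (int (a k) - int j))"
      by (rule sum.nat_diff_reindex)
    also have "\<dots> = y i ^ a k" by (rule power_eq_hsym_sum[symmetric, OF ik(1)])
    finally show "mat n n (\<lambda>(i, j). y i ^ a j) $$ (i, k) = (E * H a) $$ (i, k)" using ik by simp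
  qed (simp_all add: E_def H_def)
  then have *: "alternant_at n y a = det E * det (H a)" for a
    unfolding alternant_at_def by (simp add: det_mult[OF carr])
  \<comment> \<open>For the exponents delta the entry in row j and column k is h_{j-k}, so the
    matrix is lower triangular with ones on the diagonal; hence the determinant of \<open>E\<close>
    is the Vandermonde determinant.\<close>
  have "det (H (\<lambda>j. n - 1 - j)) = prod_list (diag_mat (H (\<lambda>j. n - 1 - j)))"
    by (rule det_lower_triangular[OF _ carr(2)]) (auto simp: H_def h_int_def)
  also have "\<dots> = 1"
    by (rule prod_list_neutral) (auto simp: diag_mat_def H_def h_int_def)
  finally show ?thesis by (simp add: * ev_h_det H_def)
qed

text \<open>The hypothesis encodes a zero part with index n: the last column is h_{-n}, ..., h_0, a
  unit vector.\<close>

lemma h_det_Suc: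
  assumes "b n = - int n"
  shows "h_det (Suc n) b = h_det n b"
proof -
  let ?A = "mat (Suc n) (Suc n) (\<lambda>(j, k). h_int (b k + int j))"
  have "det ?A = (\<Sum>i<Suc n. ?A $$ (i, n) * cofactor ?A i n)"
    by (rule laplace_expansion_column) auto
  also have "\<dots> = (\<Sum>i<Suc n. if i = n then cofactor ?A n n else 0)"
    by (intro sum.cong) (auto simp: assms h_int_def)
  also have "\<dots> = det (mat_delete ?A n n)" by (simp add: cofactor_def)
  also have "mat_delete ?A n n = mat n n (\<lambda>(j, k). h_int (b k + int j))"
    by (rule eq_matI) (auto simp: mat_delete_def)
  finally show ?thesis by (simp add: h_det_def)
qed

text \<open>Trailing zero parts do not matter, so one symmetric function serves in every large
  enough number of variables, as the definition of \<open>schur\<close> demands.\<close>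

lemma h_det_stable:
  assumes "\<And>k. k \<ge> l \<Longrightarrow> b k = - int k" "n \<ge> l"
  shows "h_det n b = h_det l b"
  using assms(2) by (induction n rule: dec_induct) (simp_all add: h_det_Suc assms(1))

lemma h_det_cong: "(\<And>k. k < n \<Longrightarrow> b k = b' k) \<Longrightarrow> h_det n b = h_det n b'"
  unfolding h_det_def by (intro arg_cong[of _ _ det] eq_matI) auto

text \<open>The left \<open>ev\<close> evaluates a polynomial in the x's, the right one a polynomial
  in the power sums. The two rings share a type, and variable number i, standing for x_{i+1},
  receives \<open>w (Suc i)\<close>.\<close>

lemma ev_realize: "ev w (realize n F) = ev (pow_sums n (\<lambda>i. w (Suc i))) F"
  unfolding realize_def
    by (rule symfun_hom_eqI[where f = "\<lambda>F. ev w (subst_psum scal (\<lambda>k. \<Sum>i<n. var i ^ k) F)"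
          and g = "ev (pow_sums n (\<lambda>i. w (Suc i)))"])
       (simp_all add: comm_ring_hom_comp[where f = "ev w", OF ev.comm_ring_hom_axioms scal.comm_ring_hom_subst_psum]
          ev.comm_ring_hom_axioms ev.hom_sum ev.hom_power pow_sums_def)

lemma ev_alternant: "ev w (alternant n a) = alternant_at n (\<lambda>i. w (Suc i)) a"
proof -
  have "map_mat (ev w) (mat n n (\<lambda>(i, j). var i ^ a j)) = mat n n (\<lambda>(i, j). w (Suc i) ^ a j)"
    by (rule eq_matI) (auto simp: ev.hom_power)
  then show ?thesis by (simp add: alternant_def alternant_at_def flip: ev.hom_det)
qed

lemma schur_exists:
  assumes "N \<ge> length \<nu>"
  shows "realize N (h_det (length \<nu>) (\<lambda>k. int (part \<nu> k) - int k)) * alternant N (\<lambda>j. N - 1 - j) =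
         alternant N (\<lambda>j. part \<nu> j + (N - 1 - j))" (is "?L = ?R")
proof -
  have "h_det (length \<nu>) (\<lambda>k. int (part \<nu> k) - int k) = h_det N (\<lambda>k. int (part \<nu> k) - int k)"
    by (rule h_det_stable[symmetric]) (use assms in \<open>auto simp: part_def\<close>)
  also have "\<dots> = h_det N (\<lambda>k. int (part \<nu> k + (N - 1 - k)) - int (N - 1))"
    by (rule h_det_cong) auto
  finally have "ev w (?L - ?R) = 0" for w
    using jacobi_trudi[of N "\<lambda>i. w (Suc i)" "\<lambda>k. part \<nu> k + (N - 1 - k)"]
    by (simp add: ev.hom_minus ev.hom_mult ev_realize ev_alternant)
  then have "?L - ?R = 0" by (rule ev_all_zero_imp_zero)
  then show ?thesis by simp
qed

lemma alternant_at_delta_neq_0: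
  fixes y :: "nat \<Rightarrow> 'a :: field"
  shows "inj_on y {..<n} \<Longrightarrow> alternant_at n y (\<lambda>j. n - 1 - j) \<noteq> 0"
  unfolding alternant_at_def by (rule det_vandermonde_neq_0)

lemma realize_alternant_ev:
  assumes "realize n F * alternant n a = alternant n b"
  shows "ev (pow_sums n y) F * alternant_at n y a = alternant_at n y b"
proof -
  have "ev (\<lambda>k. y (k - 1)) (realize n F * alternant n a) = ev (\<lambda>k. y (k - 1)) (alternant n b)"
    using assms by simp
  then show ?thesis by (simp add: ev.hom_mult ev_realize ev_alternant)
qed

text \<open>At points with distinct coordinates the Vandermonde determinant cancels, and such points
  in all large numbers of variables detect equality.\<close>

lemma schur_unique:
  assumes "\<forall>N\<ge>length \<nu>. realize N F * alternant N (\<lambda>j. N - 1 - j) = alternant N (\<lambda>j. part \<nu> j + (N - 1 - j))"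
    and "\<forall>N\<ge>length \<nu>. realize N G * alternant N (\<lambda>j. N - 1 - j) = alternant N (\<lambda>j. part \<nu> j + (N - 1 - j))"
  shows "F = G"
proof -
  have "F - G = 0"
  proof (rule ev_pow_sums_eq_0_imp_eq_0)
    fix n and y :: "nat \<Rightarrow> qfield" assume n: "n \<ge> length \<nu>" and y: "inj_on y {..<n}"
    have "ev (pow_sums n y) F * alternant_at n y (\<lambda>j. n - 1 - j) =
          ev (pow_sums n y) G * alternant_at n y (\<lambda>j. n - 1 - j)"
      using realize_alternant_ev assms n by metis
    then show "ev (pow_sums n y) (F - G) = 0"
      using alternant_at_delta_neq_0[OF y] by (simp add: ev.hom_minus)
  qed
  then show ?thesis by simp
qed

text \<open>This resolves the definite description. Nothing is divided, so the formula holds at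
  every y, also when coordinates coincide, as may happen after y_i is replaced by q^u y_i.\<close>

theorem schur_at:
  assumes "n \<ge> length \<nu>"
  shows "ev (pow_sums n y) (schur \<nu>) * alternant_at n y (\<lambda>j. n - 1 - j) =
         alternant_at n y (\<lambda>j. part \<nu> j + (n - 1 - j))"
proof -
  let ?P = "\<lambda>F. \<forall>N\<ge>length \<nu>.
    realize N F * alternant N (\<lambda>j. N - 1 - j) = alternant N (\<lambda>j. part \<nu> j + (N - 1 - j))"
  have "\<exists>!F. ?P F" using schur_exists schur_unique by blast
  then have "?P (schur \<nu>)" unfolding schur_def by (rule theI')
  then show ?thesis using assms by (blast intro: realize_alternant_ev)
qed

section \<open>Schur functions of compositions\<close>

lemma alternant_at_cong:
  "(\<And>j. j < n \<Longrightarrow> a j = b j) \<Longrightarrow> alternant_at n y a = alternant_at n y b"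
  unfolding alternant_at_def by (intro arg_cong[of _ _ det] eq_matI) auto

lemma alternant_at_repeated:
  assumes "i < n" "j < n" "i \<noteq> j" "a i = a j"
  shows "alternant_at n y a = 0"
  unfolding alternant_at_def
  by (rule det_identical_columns[of _ n i j]) (use assms in \<open>auto intro!: eq_vecI\<close>)

lemma alternant_at_leibniz:
  "alternant_at n y a = (\<Sum>p | p permutes {0..<n}. signof p * (\<Prod>i<n. y i ^ a (p i)))"
  unfolding alternant_at_def by (subst det_def') (auto intro!: sum.cong prod.cong simp: atLeast0LessThan permutes_in_image)

lemma alternant_at_permute:
  fixes y :: "nat \<Rightarrow> 'a :: comm_ring_1"
  assumes "p permutes {..<n}"
  shows "alternant_at n y (\<lambda>j. a (p j)) = of_int (sign p) * alternant_at n y a"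
proof -
  let ?A = "mat n n (\<lambda>(j, i). y i ^ a j)"
  have p: "p permutes {0..<n}" using assms by (simp add: atLeast0LessThan)
  have tr: "det (mat n n (\<lambda>(i, j). y i ^ b j)) = det (mat n n (\<lambda>(j, i). y i ^ b j))" for b
  proof -
    have "transpose_mat (mat n n (\<lambda>(i, j). y i ^ b j)) = mat n n (\<lambda>(j, i). y i ^ b j)"
      by (rule eq_matI) auto
    then show ?thesis using det_transpose[of "mat n n (\<lambda>(i, j). y i ^ b j)" n] by simp
  qed
  have "mat n n (\<lambda>(j, i). y i ^ a (p j)) = mat n n (\<lambda>(j, i). ?A $$ (p j, i))"
    using p by (intro eq_matI) (auto simp: permutes_in_image)
  then show ?thesis
    using det_permute_rows[OF _ p, of ?A] by (simp add: alternant_at_def tr)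
qed

lemma sort_desc_permutation:
  assumes "distinct b"
  shows "\<exists>!\<pi>. \<pi> permutes {..<length b} \<and> (\<forall>i<length b. sort_desc b ! i = b ! \<pi> i)"
proof -
  have "mset (sort_desc b) = mset b" by (simp add: sort_desc_def)
  then obtain \<pi> where \<pi>: "\<pi> permutes {..<length b}" "permute_list \<pi> b = sort_desc b"
    using mset_eq_permutation by metis
  show ?thesis
  proof (rule ex1I[of _ \<pi>])
    show "\<pi> permutes {..<length b} \<and> (\<forall>i<length b. sort_desc b ! i = b ! \<pi> i)"
      using \<pi> permute_list_nth[OF \<pi>(1)] by auto
  next
    fix \<rho> assume \<rho>: "\<rho> permutes {..<length b} \<and> (\<forall>i<length b. sort_desc b ! i = b ! \<rho> i)"
    show "\<rho> = \<pi>"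
    proof
      fix i
      show "\<rho> i = \<pi> i"
      proof (cases "i < length b")
        case True
        then have "b ! \<rho> i = b ! \<pi> i"
          using \<rho> \<pi> permute_list_nth[OF \<pi>(1)] by metis
        moreover have "\<rho> i < length b" "\<pi> i < length b"
          using True \<rho> \<pi>(1) permutes_in_image[of _ "{..<length b}" i] by auto
        ultimately show ?thesis using assms nth_eq_iff_index_eq by metis
      next
        case False
        then show ?thesis using \<rho> \<pi>(1) by (metis lessThan_iff permutes_not_in)
      qed
    qed
  qed
qed

text \<open>In a weakly decreasing list the zeros form the tail, so filtering them out moves no
  other entry, and \<open>part\<close> returns 0 beyond the end anyway.\<close>

lemma part_filter_antimono:
  assumes "\<And>i j. i \<le> j \<Longrightarrow> j < n \<Longrightarrow> f j \<le> f i"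
  shows "part (filter (\<lambda>k. k \<noteq> 0) (map f [0..<n])) j = (if j < n then f j else 0)"
  using assms
proof (induction n arbitrary: j)
  case (Suc n)
  have IH: "part (filter (\<lambda>k. k \<noteq> 0) (map f [0..<n])) j = (if j < n then f j else 0)" for j
    using Suc by auto
  show ?case
  proof (cases "f n = 0")
    case True
    then show ?thesis using IH[of j] by (auto simp: less_Suc_eq)
  next
    case False
    then have "f i \<noteq> 0" if "i < n" for i using Suc.prems[of i n] that by auto
    then have "filter (\<lambda>k. k \<noteq> 0) (map f [0..<n]) = map f [0..<n]" by (auto simp: filter_id_conv)
    then show ?thesis using False by (auto simp: part_def nth_append less_Suc_eq)
  qed
qed (simp add: part_def)

text \<open>A strictly decreasing sequence of naturals drops by at least 1 at each step, so entry j
  is at least length - 1 - j and the natural subtraction does not truncate.\<close>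

lemma part_minus_delta:
  assumes "sorted_wrt (>) c" "j < length c"
  shows "part (minus_delta c) j + (length c - 1 - j) = c ! j"
    and "k \<ge> length c \<Longrightarrow> part (minus_delta c) k = 0"
proof -
  have step: "c ! i \<ge> c ! j + (j - i)" if "i \<le> j" "j < length c" for i j
    using that
  proof (induction j rule: dec_induct)
    case (step j)
    then have "c ! j > c ! Suc j" using assms(1) by (simp add: sorted_wrt_iff_nth_less)
    then show ?case using step by auto
  qed simp
  have anti: "c ! j - (length c - 1 - j) \<le> c ! i - (length c - 1 - i)" if "i \<le> j" "j < length c" for i j
    using step[OF that] that by auto
  have p: "part (minus_delta c) j = (if j < length c then c ! j - (length c - 1 - j) else 0)" for j
    unfolding minus_delta_def by (rule part_filter_antimono) (rule anti)
  have "c ! j \<ge> c ! (length c - 1) + (length c - 1 - j)" by (rule step) (use assms(2) in auto)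
  then have "c ! j \<ge> length c - 1 - j" by simp
  then show "part (minus_delta c) j + (length c - 1 - j) = c ! j" using p[of j] assms(2) by simp
  show "k \<ge> length c \<Longrightarrow> part (minus_delta c) k = 0" using p[of k] by simp
qed

lemma length_minus_delta: "length (minus_delta c) \<le> length c"
  unfolding minus_delta_def by (rule order.trans[OF length_filter_le]) simp

text \<open>Straightening is invisible to alternants: a repeated entry gives two equal columns, and
  sorting costs the same sign as in the definition. The bialternant formula thus holds verbatim for
  compositions.\<close>

lemma schur_comp_at:
  assumes n: "n \<ge> length \<alpha>"
  shows "ev (pow_sums n y) (schur_comp \<alpha>) * alternant_at n y (\<lambda>j. n - 1 - j) =
         alternant_at n y (\<lambda>j. part \<alpha> j + (n - 1 - j))"
proof -
  define b where "b = plus_delta \<alpha>"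
  define N where "N = length \<alpha>"
  have lb: "length b = N" by (simp add: b_def plus_delta_def N_def)
  define \<beta> where "\<beta> j = part \<alpha> j + (n - 1 - j)" for j
  \<comment> \<open>The composition was shifted by the staircase of its own length N, the alternant
    uses that of length n; on the first N entries they differ by the constant n - N, and the sorting
    permutation fixes the remaining positions.\<close>
  have \<beta>1: "\<beta> j = b ! j + (n - N)" if "j < N" for j
    using that n by (simp add: \<beta>_def b_def plus_delta_def part_def N_def)
  have \<beta>2: "\<beta> j = n - 1 - j" if "j \<ge> N" for j
    using that by (simp add: \<beta>_def part_def N_def)
  show ?thesis
  proof (cases "distinct b")
    case False
    then obtain i j where ij: "i < N" "j < N" "i \<noteq> j" "b ! i = b ! j"
      by (auto simp: distinct_conv_nth lb)
    then have "alternant_at n y \<beta> = 0"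
      using n by (intro alternant_at_repeated[of i n j]) (auto simp: \<beta>1 N_def)
    then have "alternant_at n y (\<lambda>j. part \<alpha> j + (n - 1 - j)) = 0"
      by (simp only: \<beta>_def[abs_def])
    then show ?thesis
      using False by (simp add: schur_comp_def Let_def flip: b_def)
  next
    case True
    define c where "c = sort_desc b"
    have lc: "length c = N" by (simp add: c_def sort_desc_def lb)
    have sc: "sorted_wrt (>) c"
      using True strict_sorted_iff[of "sort b"] by (simp add: c_def sort_desc_def sorted_wrt_rev)
    define \<pi> where "\<pi> = (THE \<pi>. \<pi> permutes {..<length b} \<and> (\<forall>i < length b. sort_desc b ! i = b ! \<pi> i))"
    have "\<pi> permutes {..<length b} \<and> (\<forall>i < length b. sort_desc b ! i = b ! \<pi> i)"
      unfolding \<pi>_def by (rule theI'[OF sort_desc_permutation[OF True]])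
    then have \<pi>: "\<pi> permutes {..<N}" "\<And>i. i < N \<Longrightarrow> c ! i = b ! \<pi> i"
      by (simp_all add: lb c_def)
    have \<pi>n: "\<pi> permutes {..<n}"
      by (rule permutes_subset[OF \<pi>(1)]) (use n in \<open>auto simp: N_def\<close>)
    have len: "length (minus_delta c) \<le> n"
      using length_minus_delta[of c] n by (simp add: lc N_def)
    have exps: "part (minus_delta c) j + (n - 1 - j) = \<beta> (\<pi> j)" if "j < n" for j
    proof (cases "j < N")
      case True
      then have "\<pi> j < N" using \<pi>(1) permutes_in_image[of \<pi> "{..<N}" j] by simp
      then have "\<beta> (\<pi> j) = c ! j + (n - N)" by (simp add: \<beta>1 \<pi>(2) True)
      also have "c ! j = part (minus_delta c) j + (N - 1 - j)"
        using part_minus_delta(1)[OF sc] True by (simp add: lc)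
      finally show ?thesis using True n by (simp add: N_def)
    next
      case False
      then have "\<pi> j = j" using \<pi>(1) by (simp add: permutes_not_in)
      moreover have "part (minus_delta c) j = 0"
      \<comment> \<open>\<open>part_minus_delta\<close> asks for some valid index of
        \<open>c\<close>, so the empty composition is treated apart.\<close>
      proof (cases "N = 0")
        case True then show ?thesis using lc by (simp add: minus_delta_def part_def)
      next
        case N: False
        then show ?thesis using part_minus_delta(2)[OF sc, of 0 j] False by (simp add: lc)
      qed
      ultimately show ?thesis using False by (simp add: \<beta>2)
    qed
    have "ev (pow_sums n y) (schur (minus_delta c)) * alternant_at n y (\<lambda>j. n - 1 - j) =
          alternant_at n y (\<lambda>j. part (minus_delta c) j + (n - 1 - j))"
      by (rule schur_at[OF len])
    also have "\<dots> = alternant_at n y (\<lambda>j. \<beta> (\<pi> j))"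
      by (rule alternant_at_cong) (rule exps)
    also have "\<dots> = of_int (sign \<pi>) * alternant_at n y \<beta>"
      by (rule alternant_at_permute[OF \<pi>n])
    finally have *: "ev (pow_sums n y) (schur (minus_delta c)) * alternant_at n y (\<lambda>j. n - 1 - j) =
      of_int (sign \<pi>) * alternant_at n y \<beta>" .
    \<comment> \<open>The sign occurs twice, once from the definition and once from permuting
      columns, and squares to 1.\<close>
    have sg: "of_int (sign \<pi>) * (of_int (sign \<pi>) * x) = (x :: qfield)" for x
      by (simp add: sign_def)
    have "schur_comp \<alpha> = of_int (sign \<pi>) * schur (minus_delta c)"
      using True by (simp add: schur_comp_def Let_def sort_sign_def \<pi>_def c_def b_def)
    then have "ev (pow_sums n y) (schur_comp \<alpha>) * alternant_at n y (\<lambda>j. n - 1 - j) =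
      of_int (sign \<pi>) * (ev (pow_sums n y) (schur (minus_delta c)) * alternant_at n y (\<lambda>j. n - 1 - j))"
      by (simp add: ev.hom_mult ev.hom_of_int)
    also have "\<dots> = alternant_at n y \<beta>" unfolding * by (rule sg)
    finally show ?thesis by (simp add: \<beta>_def[abs_def])
  qed
qed

section \<open>The operators on Laurent series\<close>

no_notation fls_nth (infixl "$$" 75)

lemma dist_fps_to_fls: "dist (fps_to_fls f) (fps_to_fls g) = dist f (g :: 'a :: group_add fps)"
proof -
  have "fls_subdegree (fps_to_fls f - fps_to_fls g) = int (subdegree (f - g))"
    by (simp flip: fps_to_fls_minus add: fls_subdegree_fls_to_fps)
  then show ?thesis by (simp add: dist_fls_def dist_fps_def)
qed

lemma fps_to_fls_sum: "fps_to_fls (sum f A) = (\<Sum>x\<in>A. fps_to_fls (f x))"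
  by (induction A rule: infinite_finite_induct) auto

text \<open>Each coefficient receives finitely many contributions, which gives z-adic convergence.
  Both infinite sums in \<open>Omega\<close> and \<open>exp_z\<close> are evaluated this
  way.\<close>

lemma sums_fps_to_fls:
  fixes f :: "nat \<Rightarrow> 'a :: ab_group_add fps"
  assumes "\<And>k m. m < k \<Longrightarrow> fps_nth (f k) m = 0"
  shows "(\<lambda>k. fps_to_fls (f k)) sums fps_to_fls (Abs_fps (\<lambda>m. \<Sum>k\<le>m. fps_nth (f k) m))"
proof -
  let ?S = "Abs_fps (\<lambda>m. \<Sum>k\<le>m. fps_nth (f k) m)"
  have "(\<lambda>N. \<Sum>k<N. f k) \<longlonglongrightarrow> ?S"
  proof (rule tendsto_fpsI)
    fix m
    have "fps_nth (\<Sum>k<N. f k) m = fps_nth ?S m" if "N > m" for N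
    proof -
      have "(\<Sum>k<N. fps_nth (f k) m) = (\<Sum>k\<le>m. fps_nth (f k) m)"
        using that assms by (intro sum.mono_neutral_right) auto
      then show ?thesis by (simp add: fps_sum_nth)
    qed
    then show "\<forall>\<^sub>F N in sequentially. fps_nth (\<Sum>k<N. f k) m = fps_nth ?S m"
      by (auto intro: eventually_mono[OF eventually_gt_at_top[of m]])
  qed
  then show ?thesis
    by (simp add: sums_def tendsto_iff dist_fps_to_fls flip: fps_to_fls_sum)
qed

lemma comm_ring_hom_fls_const: "comm_ring_hom (fls_const :: 'a :: comm_ring_1 \<Rightarrow> 'a fls)"
  by unfold_locales (auto simp: fls_plus_const)

lemma comm_ring_hom_scal_z: "comm_ring_hom scal_z"
  using comm_ring_hom_comp[OF comm_ring_hom_fls_const scal.comm_ring_hom_axioms]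
  by (simp add: scal_z_def[abs_def])

lemma scalar_hom_scal_z: "scalar_hom scal_z"
  by (rule scalar_hom.intro) (rule comm_ring_hom_scal_z)

context
  fixes k :: nat
  assumes k: "k > 0"
begin

lemma scalar_hom_scal_adams_q: "scalar_hom (\<lambda>c. scal (adams_q k c))"
  by (rule scalar_hom.intro, rule comm_ring_hom_comp[OF scal.comm_ring_hom_axioms comm_ring_hom_adams_q[OF k]])

lemma comm_ring_hom_adams: "comm_ring_hom (adams k)"
  unfolding adams_def[abs_def] by (rule scalar_hom.comm_ring_hom_subst_psum[OF scalar_hom_scal_adams_q])

lemma adams_scal: "adams k (scal c) = scal (adams_q k c)"
  unfolding adams_def by (rule scalar_hom.subst_psum_scal[OF scalar_hom_scal_adams_q])

lemma adams_psum: "j > 0 \<Longrightarrow> adams k (psum j) = psum (j * k)"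
  unfolding adams_def by (rule scalar_hom.subst_psum_psum[OF scalar_hom_scal_adams_q])

lemma adams_X: "adams k X = psum k"
  by (simp add: X_def adams_psum)

lemma adams_z_nonpos:
  "adams_z k (fls_const X + scal_z d * fls_X_inv) =
   fls_const (psum k) + scal_z (adams_q k d) * fls_X_inv ^ k"
proof -
  interpret a: comm_ring_hom "adams k" by (rule comm_ring_hom_adams)
  have "(\<lambda>n. adams k (fls_nth (fls_const X + scal_z d * fls_X_inv) n)) =
        fls_nth (fls_const (psum k) + scal_z (adams_q k d) * fls_X_inv)"
    by (rule ext) (simp add: scal_z_def a.hom_add adams_X adams_scal)
  then have "Abs_fls (\<lambda>n. adams k (fls_nth (fls_const X + scal_z d * fls_X_inv) n)) =
        fls_const (psum k) + scal_z (adams_q k d) * fls_X_inv"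
    by (simp add: fls_nth_inverse)
  then show ?thesis
    using k by (simp add: adams_z_def scal_z_def fls_X_inv_power_conv_shift_1)
qed

lemma adams_z_linear:
  "adams_z k (fls_const s * fls_X) = fps_to_fls (fps_const (adams k s) * fps_X ^ k)"
proof -
  interpret a: comm_ring_hom "adams k" by (rule comm_ring_hom_adams)
  have "(\<lambda>n. adams k (fls_nth (fls_const s * fls_X) n)) = fls_nth (fls_const (adams k s) * fls_X)"
    by (rule ext) simp
  then have "Abs_fls (\<lambda>n. adams k (fls_nth (fls_const s * fls_X) n)) = fls_const (adams k s) * fls_X"
    by (simp add: fls_nth_inverse)
  then show ?thesis
    using k by (simp add: adams_z_def fls_times_fps_to_fls fps_to_fls_power fls_X_power_conv_shift_1)
qed

end

text \<open>The exponent of Omega[sz]: p_m[sz]/m equals p_m[s] z^m / m.\<close>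

definition log_Omega :: "symfun \<Rightarrow> symfun fps" where
  "log_Omega s = Abs_fps (\<lambda>m. if m = 0 then 0 else scal (1 / of_nat m) * adams m s)"

lemma Omega_linear:
  "Omega (fls_const s * fls_X) =
   fps_to_fls (Abs_fps (\<lambda>m. \<Sum>n\<le>m. scal (1 / fact n) * fps_nth (log_Omega s ^ n) m))"
proof -
  define f where "f k = fps_const (scal (1 / of_nat (Suc k)) * adams (Suc k) s) * fps_X ^ Suc k" for k
  have "scal_z (1 / of_nat (Suc k)) * adams_z (Suc k) (fls_const s * fls_X) = fps_to_fls (f k)" for k
    by (simp add: adams_z_linear scal_z_def f_def fls_times_fps_to_fls mult.assoc
          del: of_nat_Suc power_Suc flip: fls_const_mult_const)
  moreover have "(\<lambda>k. fps_to_fls (f k)) sums fps_to_fls (Abs_fps (\<lambda>m. \<Sum>k\<le>m. fps_nth (f k) m))"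
    by (rule sums_fps_to_fls) (simp add: f_def fps_X_power_iff del: of_nat_Suc power_Suc)
  moreover have "Abs_fps (\<lambda>m. \<Sum>k\<le>m. fps_nth (f k) m) = log_Omega s"
  proof (rule fps_ext)
    fix m
    have "(\<Sum>k\<le>m. fps_nth (f k) m) =
      (\<Sum>k\<le>m. if Suc k = m then scal (1 / of_nat (Suc k)) * adams (Suc k) s else 0)"
      by (intro sum.cong) (auto simp: f_def fps_X_power_iff simp del: of_nat_Suc power_Suc)
    also have "\<dots> = fps_nth (log_Omega s) m"
      by (cases m) (simp_all add: log_Omega_def sum.atMost_Suc del: of_nat_Suc)
    finally show "fps_nth (Abs_fps (\<lambda>m. \<Sum>k\<le>m. fps_nth (f k) m)) m = fps_nth (log_Omega s) m" by simp
  qed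
  ultimately have log: "suminf (\<lambda>k. scal_z (1 / of_nat (Suc k)) * adams_z (Suc k) (fls_const s * fls_X)) =
      fps_to_fls (log_Omega s)"
    by (simp add: sums_iff del: of_nat_Suc)
  define g where "g n = fps_const (scal (1 / fact n)) * log_Omega s ^ n" for n
  have "fps_nth (g n) m = 0" if "m < n" for n m
    using startsby_zero_power_prefix[of "log_Omega s" n] that by (simp add: g_def log_Omega_def)
  then have "(\<lambda>n. fps_to_fls (g n)) sums fps_to_fls (Abs_fps (\<lambda>m. \<Sum>n\<le>m. fps_nth (g n) m))"
    by (rule sums_fps_to_fls)
  moreover have "scal_z (1 / fact n) * fps_to_fls (log_Omega s) ^ n = fps_to_fls (g n)" for n
    by (simp add: g_def scal_z_def fls_times_fps_to_fls fps_to_fls_power)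
  ultimately show ?thesis
    unfolding Omega_def exp_z_def log by (simp add: sums_iff g_def)
qed

lemma hom_fps_nth_power:
  assumes "comm_ring_hom h"
  shows "h (fps_nth (F ^ n) m) = fps_nth (Abs_fps (\<lambda>i. h (fps_nth F i)) ^ n) m"
proof -
  interpret h: comm_ring_hom h by fact
  show ?thesis
    by (induction n arbitrary: m) (simp_all add: fps_mult_nth h.hom_sum h.hom_mult)
qed

text \<open>If p_k[s] specializes to the power sums of an alphabet x minus those of b, then
  Omega[sz] becomes the product of (1 - b_j z)/(1 - x_j z). Coefficients of \<open>Omega\<close> are
  finite sums, so the homomorphism acts on them without any continuity; the image is exp composed
  with a series l, and its derivative is l' times itself.\<close>

lemma hom_Omega_linear:
  fixes \<phi> :: "symfun \<Rightarrow> qfield"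
  assumes \<phi>: "comm_ring_hom \<phi>" and scal: "\<And>c. \<phi> (scal c) = c"
    and s: "\<And>k. k > 0 \<Longrightarrow> \<phi> (adams k s) = pow_sums n x k - pow_sums n b k"
  shows "Abs_fps (\<lambda>m. \<phi> (fls_nth (Omega (fls_const s * fls_X)) (int m))) * root_prod n x = root_prod n b"
proof -
  interpret \<phi>: comm_ring_hom \<phi> by fact
  define l where "l = Abs_fps (\<lambda>i. \<phi> (fps_nth (log_Omega s) i))"
  have l0: "fps_nth l 0 = 0" by (simp add: l_def log_Omega_def)
  have lS: "of_nat (Suc k) * fps_nth l (Suc k) = pow_sums n x (Suc k) - pow_sums n b (Suc k)" for k
    by (simp add: l_def log_Omega_def \<phi>.hom_mult scal s del: of_nat_Suc)
  define E where "E = fps_compose (fps_exp 1) l"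
  have "\<phi> (fls_nth (Omega (fls_const s * fls_X)) (int m)) = fps_nth E m" for m
    by (simp add: Omega_linear E_def fps_compose_nth \<phi>.hom_sum \<phi>.hom_mult scal hom_fps_nth_power[OF \<phi>]
        atLeast0AtMost flip: l_def)
  then have "Abs_fps (\<lambda>m. \<phi> (fls_nth (Omega (fls_const s * fls_X)) (int m))) = E"
    by (simp add: fps_eq_iff)
  moreover have "E * root_prod n x = root_prod n b"
  proof (rule fps_exp_power_sums)
    have dE: "fps_deriv E = fps_deriv l * E"
      unfolding E_def by (subst fps_compose_deriv[OF l0]) (simp add: mult.commute)
    fix m
    have "of_nat (Suc m) * fps_nth E (Suc m) = fps_nth (fps_deriv E) m" by simp
    also have "\<dots> = (\<Sum>k\<le>m. (pow_sums n x (Suc k) - pow_sums n b (Suc k)) * fps_nth E (m - k))"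
      unfolding dE fps_mult_nth atLeast0AtMost using lS by (simp del: of_nat_Suc)
    finally show "of_nat (Suc m) * fps_nth E (Suc m) =
      (\<Sum>k\<le>m. (pow_sums n x (Suc k) - pow_sums n b (Suc k)) * fps_nth E (m - k))" .
  qed (simp add: E_def l0)
  ultimately show ?thesis by simp
qed

section \<open>Extraction of the coefficient of z^v\<close>

definition eval_inv :: "symfun poly \<Rightarrow> symfun fls" where
  "eval_inv Q = poly (map_poly fls_const Q) fls_X_inv"

lemma comm_ring_hom_map_poly: "comm_ring_hom h \<Longrightarrow> comm_ring_hom (map_poly h)"
proof -
  assume "comm_ring_hom h"
  then interpret h: map_poly_comm_ring_hom h by (simp add: map_poly_comm_ring_hom_def)
  show ?thesis by (rule h.comm_ring_hom_axioms)
qed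

lemma map_poly_const: "f 0 = 0 \<Longrightarrow> map_poly f [:c:] = [:f c:]"
  by (cases "c = 0") (simp_all add: map_poly_pCons)

lemma comm_ring_hom_poly: "comm_ring_hom (\<lambda>p. poly p (a :: 'a :: comm_ring_1))"
  by unfold_locales auto

lemma fls_nth_eval_inv_mult:
  "fls_nth (eval_inv Q * B) v = (\<Sum>k\<le>degree Q. coeff Q k * fls_nth B (v + int k))"
proof -
  have "eval_inv Q = (\<Sum>k\<le>degree Q. fls_const (coeff Q k) * fls_X_inv ^ k)"
    by (simp add: eval_inv_def poly_altdef coeff_map_poly degree_map_poly)
  then have "eval_inv Q * B = (\<Sum>k\<le>degree Q. fls_const (coeff Q k) * (fls_X_inv ^ k * B))"
    by (simp add: sum_distrib_right mult.assoc)
  then show ?thesis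
    by (simp add: fls_nth_sum fls_X_inv_power_times_conv_shift)
qed

text \<open>The coefficient extraction in \<open>D\<close> pairs the polynomial \<open>F[Y + d/z]\<close> in \<open>1/z\<close> with the coefficients
  of \<open>B\<close>; when these are a combination of geometric progressions, the pairing evaluates the polynomial.\<close>

lemma hom_pleth_z_coeff:
  fixes \<phi> :: "symfun \<Rightarrow> qfield"
  assumes \<phi>: "comm_ring_hom \<phi>" and scal: "\<And>c. \<phi> (scal c) = c"
    and B: "\<And>k. \<phi> (fls_nth B (v + int k)) = (\<Sum>i<n. \<gamma> i * x i ^ k)"
  shows "\<phi> (fls_nth (pleth_z (pleth F (scal r * X)) (fls_const X + scal_z d * fls_X_inv) * B) v) =
    (\<Sum>i<n. \<gamma> i * ev (\<lambda>k. adams_q k r * (\<phi> (psum k) + adams_q k d * x i ^ k)) F)"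
proof -
  interpret \<phi>: comm_ring_hom \<phi> by fact
  \<comment> \<open>The image of p_k in F[r(X + dw)], with w = 1/z as polynomial variable; the
    scalars r and d undergo the Adams operation too.\<close>
  define g where "g k = [:scal (adams_q k r) * psum k:] + monom (scal (adams_q k r * adams_q k d)) k" for k
  define Q where "Q F = subst_psum (\<lambda>c. [:scal c:]) g F" for F
  have cp: "scalar_hom (\<lambda>c. [:scal c:])"
    by unfold_locales (auto simp: scal.hom_add scal.hom_mult)
  have Qhom: "comm_ring_hom Q" and Qscal: "Q (scal c) = [:scal c:]" and Qpsum: "k > 0 \<Longrightarrow> Q (psum k) = g k" for c k
    unfolding Q_def[abs_def]
    by (rule scalar_hom.comm_ring_hom_subst_psum[OF cp], rule scalar_hom.subst_psum_scal[OF cp],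
        rule scalar_hom.subst_psum_psum[OF cp])
  let ?E = "fls_const X + scal_z d * fls_X_inv"
  have zhom: "comm_ring_hom (\<lambda>F. pleth_z F ?E)"
    unfolding pleth_z_def by (rule scalar_hom.comm_ring_hom_subst_psum[OF scalar_hom_scal_z])
  interpret z: comm_ring_hom "\<lambda>F. pleth_z F ?E" by (rule zhom)
  have zscal: "pleth_z (scal c) ?E = scal_z c" for c
    unfolding pleth_z_def by (rule scalar_hom.subst_psum_scal[OF scalar_hom_scal_z])
  have zpsum: "k > 0 \<Longrightarrow> pleth_z (psum k) ?E = fls_const (psum k) + scal_z (adams_q k d) * fls_X_inv ^ k" for k
    unfolding pleth_z_def by (subst scalar_hom.subst_psum_psum[OF scalar_hom_scal_z]) (simp_all add: adams_z_nonpos)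
  have "pleth_z (pleth F (scal r * X)) ?E = eval_inv (Q F)"
  proof (rule symfun_hom_eqI[where f = "\<lambda>F. pleth_z (pleth F (scal r * X)) ?E" and g = "\<lambda>F. eval_inv (Q F)"])
    show "comm_ring_hom (\<lambda>F. pleth_z (pleth F (scal r * X)) ?E)"
      unfolding pleth_def by (rule comm_ring_hom_comp[OF zhom scal.comm_ring_hom_subst_psum])
    show "comm_ring_hom (\<lambda>F. eval_inv (Q F))"
      unfolding eval_inv_def
      by (rule comm_ring_hom_comp[OF comm_ring_hom_comp[OF comm_ring_hom_poly comm_ring_hom_map_poly[OF comm_ring_hom_fls_const]] Qhom])
    show "pleth_z (pleth (scal c) (scal r * X)) ?E = eval_inv (Q (scal c))" for c
      by (simp add: pleth_def zscal Qscal eval_inv_def map_poly_const) (simp add: scal_z_def)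
    fix k :: nat assume k: "k > 0"
    interpret a: comm_ring_hom "adams k" by (rule comm_ring_hom_adams[OF k])
    interpret f: comm_ring_hom "map_poly (fls_const :: symfun \<Rightarrow> symfun fls)"
      by (rule comm_ring_hom_map_poly[OF comm_ring_hom_fls_const])
    show "pleth_z (pleth (psum k) (scal r * X)) ?E = eval_inv (Q (psum k))"
      using k by (simp add: pleth_def a.hom_mult adams_scal adams_X z.hom_mult zscal zpsum Qpsum g_def eval_inv_def
            f.hom_add map_poly_const map_poly_monom poly_monom)
        (simp add: scal_z_def distrib_left scal.hom_mult flip: mult.assoc)
  qed
  then have "\<phi> (fls_nth (pleth_z (pleth F (scal r * X)) ?E * B) v) =
      (\<Sum>k\<le>degree (Q F). \<phi> (coeff (Q F) k) * (\<Sum>i<n. \<gamma> i * x i ^ k))"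
    by (simp add: fls_nth_eval_inv_mult \<phi>.hom_sum \<phi>.hom_mult B)
  also have "\<dots> = (\<Sum>i<n. \<gamma> i * (\<Sum>k\<le>degree (Q F). \<phi> (coeff (Q F) k) * x i ^ k))"
    by (simp add: sum_distrib_left mult_ac) (rule sum.swap)
  also have "\<dots> = (\<Sum>i<n. \<gamma> i * ev (\<lambda>k. adams_q k r * (\<phi> (psum k) + adams_q k d * x i ^ k)) F)"
  proof (intro sum.cong refl arg_cong2[of _ _ _ _ "(*)"])
    fix i
    have "(\<Sum>k\<le>degree (Q F). \<phi> (coeff (Q F) k) * x i ^ k) = poly (map_poly \<phi> (Q F)) (x i)"
    proof -
      have "(\<Sum>k\<le>degree (Q F). \<phi> (coeff (Q F) k) * x i ^ k) =
            (\<Sum>k\<le>degree (map_poly \<phi> (Q F)). \<phi> (coeff (Q F) k) * x i ^ k)"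
      \<comment> \<open>The homomorphism may kill leading coefficients, so the degree can drop; the
        surplus summands are 0.\<close>
      proof (rule sum.mono_neutral_right)
        show "\<forall>k\<in>{..degree (Q F)} - {..degree (map_poly \<phi> (Q F))}. \<phi> (coeff (Q F) k) * x i ^ k = 0"
        proof
          fix k assume "k \<in> {..degree (Q F)} - {..degree (map_poly \<phi> (Q F))}"
          then have "coeff (map_poly \<phi> (Q F)) k = 0" by (intro coeff_eq_0) auto
          then show "\<phi> (coeff (Q F) k) * x i ^ k = 0" by (simp add: coeff_map_poly)
        qed
      qed (auto intro: order.trans[OF _ degree_map_poly_le])
      then show ?thesis by (simp add: poly_altdef coeff_map_poly)
    qed
    also have "\<dots> = ev (\<lambda>k. adams_q k r * (\<phi> (psum k) + adams_q k d * x i ^ k)) F"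
    proof (rule symfun_hom_eqI[where f = "\<lambda>F. poly (map_poly \<phi> (Q F)) (x i)" and
          g = "ev (\<lambda>k. adams_q k r * (\<phi> (psum k) + adams_q k d * x i ^ k))"])
      show "comm_ring_hom (\<lambda>F. poly (map_poly \<phi> (Q F)) (x i))"
        by (rule comm_ring_hom_comp[OF comm_ring_hom_comp[OF comm_ring_hom_poly comm_ring_hom_map_poly[OF \<phi>]] Qhom])
      interpret m: comm_ring_hom "map_poly \<phi>" by (rule comm_ring_hom_map_poly[OF \<phi>])
      show "poly (map_poly \<phi> (Q (scal c))) (x i) = ev (\<lambda>k. adams_q k r * (\<phi> (psum k) + adams_q k d * x i ^ k)) (scal c)" for c
        by (simp add: Qscal map_poly_const scal)
      fix k :: nat assume k: "k > 0"
      then show "poly (map_poly \<phi> (Q (psum k))) (x i) =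
          ev (\<lambda>k. adams_q k r * (\<phi> (psum k) + adams_q k d * x i ^ k)) (psum k)"
        by (simp add: Qpsum g_def m.hom_add map_poly_const map_poly_monom poly_monom \<phi>.hom_mult scal algebra_simps)
    qed (rule ev.comm_ring_hom_axioms)
    finally show "(\<Sum>k\<le>degree (Q F). \<phi> (coeff (Q F) k) * x i ^ k) =
       ev (\<lambda>k. adams_q k r * (\<phi> (psum k) + adams_q k d * x i ^ k)) F" .
  qed
  finally show ?thesis .
qed

section \<open>Partial fractions\<close>

lemma linear_factors_coeff:
  fixes b :: "nat \<Rightarrow> 'a :: comm_ring_1"
  assumes "finite A"
  shows "k > card A \<Longrightarrow> coeff (\<Prod>j\<in>A. [:1, - b j:]) k = 0"
    and "coeff (\<Prod>j\<in>A. [:1, - b j:]) (card A) = (\<Prod>j\<in>A. - b j)"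
proof -
  have "(\<forall>k>card A. coeff (\<Prod>j\<in>A. [:1, - b j:]) k = 0) \<and>
        coeff (\<Prod>j\<in>A. [:1, - b j:]) (card A) = (\<Prod>j\<in>A. - b j)"
    using assms
  proof (induction A rule: finite_induct)
    case (insert i A)
    let ?P = "\<Prod>j\<in>A. [:1, - b j:]"
    have "(\<Prod>j\<in>insert i A. [:1, - b j:]) = ?P + pCons 0 (Polynomial.smult (- b i) ?P)"
      using insert by simp
    then show ?case using insert by (auto simp: coeff_pCons split: nat.splits)
  qed simp
  then show "k > card A \<Longrightarrow> coeff (\<Prod>j\<in>A. [:1, - b j:]) k = 0"
    and "coeff (\<Prod>j\<in>A. [:1, - b j:]) (card A) = (\<Prod>j\<in>A. - b j)" by auto
qed

text \<open>The coefficient of 1/(1 - y_i z) in the partial fractions of the product of (1 - y_j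
  z/a)/(1 - y_j z): the numerator over the other denominators, at z = 1/y_i.\<close>

definition residue :: "nat \<Rightarrow> 'a :: field \<Rightarrow> (nat \<Rightarrow> 'a) \<Rightarrow> nat \<Rightarrow> 'a" where
  "residue n a y i = (\<Prod>j<n. 1 - y j / (a * y i)) / (\<Prod>j\<in>{..<n} - {i}. 1 - y j / y i)"

lemma fps_of_poly_linear_factors:
  fixes b :: "nat \<Rightarrow> 'a :: comm_ring_1"
  shows "fps_of_poly (\<Prod>j\<in>A. [:1, - b j:]) = (\<Prod>j\<in>A. 1 - fps_const (b j) * fps_X)"
proof -
  have lin: "fps_of_poly [:1, - c:] = 1 - fps_const c * fps_X" for c :: 'a
    by (rule fps_ext) (simp add: coeff_pCons split: nat.splits)
  show ?thesis unfolding fps_of_poly_prod lin ..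
qed

text \<open>The top coefficients of the two full products differ by the factor a^(-n), so the
  difference of both sides has degree below n, and it vanishes at the n distinct points
  1/x_i.\<close>

lemma partial_fractions_poly:
  fixes x :: "nat \<Rightarrow> 'a :: field"
  assumes inj: "inj_on x {..<n}" and nz: "\<forall>i<n. x i \<noteq> 0" and a: "a \<noteq> 0"
  shows "(\<Prod>j<n. [:1, - (x j / a):]) = Polynomial.smult ((1 / a) ^ n) (\<Prod>j<n. [:1, - x j:]) +
    (\<Sum>i<n. Polynomial.smult (residue n a x i) (\<Prod>j\<in>{..<n} - {i}. [:1, - x j:]))" (is "?N = ?R")
proof -
  have "?N - ?R = 0"
  proof (rule poly_eq_0_if_roots)
    show "inj_on (\<lambda>i. 1 / x i) {..<n}" using inj nz by (auto simp: inj_on_def)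
  next
    fix k assume k: "k \<ge> n"
    have "coeff (\<Prod>j\<in>{..<n} - {i}. [:1, - x j:]) k = 0" if "i < n" for i
      using k that by (intro linear_factors_coeff(1)) auto
    moreover have "coeff ?N k = (1 / a) ^ n * coeff (\<Prod>j<n. [:1, - x j:]) k"
    proof (cases "k = n")
      case True
      have "(\<Prod>j<n. - (x j / a)) = (\<Prod>j<n. (1 / a) * (- x j))" by (intro prod.cong) auto
      also have "\<dots> = (1 / a) ^ n * (\<Prod>j<n. - x j)" by (simp only: prod.distrib prod_constant card_lessThan)
      finally show ?thesis
        using linear_factors_coeff(2)[of "{..<n}" "\<lambda>j. x j / a"] linear_factors_coeff(2)[of "{..<n}" x] True
        by simp
    next
      case False
      then show ?thesis using k linear_factors_coeff(1)[of "{..<n}" k x]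
          linear_factors_coeff(1)[of "{..<n}" k "\<lambda>j. x j / a"] by simp
    qed
    ultimately show "coeff (?N - ?R) k = 0" by (simp add: coeff_sum)
  next
    fix i assume i: "i < n"
    let ?z = "1 / x i"
    have ne: "x i \<noteq> 0" using nz i by blast
    have "poly (\<Prod>j\<in>{..<n} - {l}. [:1, - x j:]) ?z = 0" if "l < n" "l \<noteq> i" for l
      unfolding poly_prod using i that ne by (intro prod_zero) auto
    then have "(\<Sum>l<n. residue n a x l * poly (\<Prod>j\<in>{..<n} - {l}. [:1, - x j:]) ?z) =
      (\<Sum>l<n. if l = i then residue n a x i * poly (\<Prod>j\<in>{..<n} - {i}. [:1, - x j:]) ?z else 0)"
      by (intro sum.cong) auto
    also have "\<dots> = residue n a x i * (\<Prod>j\<in>{..<n} - {i}. 1 - x j / x i)"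
      using i by (simp add: poly_prod)
    also have "\<dots> = (\<Prod>j<n. 1 - x j / (a * x i))"
    proof -
      have "(\<Prod>j\<in>{..<n} - {i}. 1 - x j / x i) \<noteq> 0"
        using inj i ne by (auto simp: inj_on_def)
      then show ?thesis by (simp add: residue_def)
    qed
    also have "\<dots> = poly ?N ?z" by (simp add: poly_prod mult.commute)
    finally have 1: "(\<Sum>l<n. residue n a x l * poly (\<Prod>j\<in>{..<n} - {l}. [:1, - x j:]) ?z) = poly ?N ?z" .
    have "poly (\<Prod>j<n. [:1, - x j:]) ?z = 0"
      unfolding poly_prod using i ne by (intro prod_zero) auto
    then show "poly (?N - ?R) ?z = 0" using 1 by (simp add: poly_sum)
  qed
  then show ?thesis by simp
qed

text \<open>The constant a^(-n) contributes to the coefficient of index 0 only, which m > 0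
  excludes; what remains is a combination of geometric progressions.\<close>

lemma partial_fractions_coeff:
  fixes x :: "nat \<Rightarrow> 'a :: field"
  assumes inj: "inj_on x {..<n}" and nz: "\<forall>i<n. x i \<noteq> 0" and a: "a \<noteq> 0"
    and R: "R * root_prod n x = root_prod n (\<lambda>j. x j / a)" and m: "m > 0"
  shows "fps_nth R m = (\<Sum>i<n. residue n a x i * x i ^ m)"
proof -
  define S where "S = fps_const ((1 / a) ^ n) + (\<Sum>i<n. fps_const (residue n a x i) * geo (x i))"
  have geo: "geo (x i) * root_prod n x = co_root_prod n x i" if "i < n" for i
  proof -
    have "root_prod n x = (1 - fps_const (x i) * fps_X) * co_root_prod n x i"
      unfolding root_prod_def co_root_prod_def using that by (simp add: prod.remove)
    then have "geo (x i) * root_prod n x = (geo (x i) * (1 - fps_const (x i) * fps_X)) * co_root_prod n x i"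
      by (simp only: mult.assoc)
    then show ?thesis by (simp only: geo_mult mult_1_left)
  qed
  have "fps_of_poly (\<Prod>j<n. [:1, - (x j / a):]) = fps_const ((1 / a) ^ n) * root_prod n x +
    (\<Sum>i<n. fps_const (residue n a x i) * co_root_prod n x i)"
    unfolding partial_fractions_poly[OF inj nz a]
    by (simp add: fps_of_poly_add fps_of_poly_sum fps_of_poly_smult fps_of_poly_linear_factors
        root_prod_def co_root_prod_def)
  also have "fps_of_poly (\<Prod>j<n. [:1, - (x j / a):]) = root_prod n (\<lambda>j. x j / a)"
    by (simp only: fps_of_poly_linear_factors root_prod_def)
  also have "fps_const ((1 / a) ^ n) * root_prod n x + (\<Sum>i<n. fps_const (residue n a x i) * co_root_prod n x i) =
    S * root_prod n x"
    by (simp add: S_def distrib_right sum_distrib_right mult.assoc geo)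
  finally have "R * root_prod n x = S * root_prod n x" using R by simp
  moreover have "root_prod n x \<noteq> 0"
  proof -
    have "fps_nth (root_prod n x) 0 = 1" by (induction n) (simp_all add: root_prod_def)
    then show ?thesis by auto
  qed
  ultimately have "R = S" by simp
  then show ?thesis using m by (simp add: S_def fps_sum_nth geo_def)
qed

lemma residue_scale: "c \<noteq> 0 \<Longrightarrow> residue n a (\<lambda>i. c * y i) i = residue n a y i"
  by (simp add: residue_def mult.left_commute)

section \<open>Residues as ratios of Vandermonde determinants\<close>

lemma alternant_at_delta_row_poly:
  fixes y :: "nat \<Rightarrow> 'a :: comm_ring_1"
  assumes i: "i < n"
  shows "\<exists>P. (\<forall>k\<ge>n. coeff P k = 0) \<and> (\<forall>w. poly P w = alternant_at n (y(i := w)) (\<lambda>j. n - 1 - j))"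
proof -
  define A where "A w = mat n n (\<lambda>(k, j). (y(i := w)) k ^ (n - 1 - j))" for w
  define P where "P = (\<Sum>j<n. monom (cofactor (A 0) i j) (n - 1 - j))"
  have cof: "cofactor (A w) i j = cofactor (A 0) i j" for w j
  proof -
    have "mat_delete (A w) i j = mat_delete (A 0) i j"
      by (rule eq_matI) (auto simp: mat_delete_def A_def)
    then show ?thesis by (simp add: cofactor_def)
  qed
  have "poly P w = alternant_at n (y(i := w)) (\<lambda>j. n - 1 - j)" for w
  proof -
    have "det (A w) = (\<Sum>j<n. A w $$ (i, j) * cofactor (A w) i j)"
      by (rule laplace_expansion_row[OF _ i]) (simp add: A_def)
    also have "\<dots> = poly P w"
      using i by (simp add: cof[of w] P_def poly_sum poly_monom) (simp add: A_def mult.commute)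
    finally show ?thesis by (simp add: alternant_at_def A_def)
  qed
  moreover have "coeff P k = 0" if "k \<ge> n" for k
    unfolding P_def coeff_sum using that by (intro sum.neutral) auto
  ultimately show ?thesis by blast
qed

lemma alternant_at_identical:
  assumes "i < n" "k < n" "i \<noteq> k" "y i = y k"
  shows "alternant_at n y a = 0"
  unfolding alternant_at_def
  by (rule det_identical_rows[of _ n i k]) (use assms in \<open>auto intro!: eq_vecI\<close>)

text \<open>Both sides are polynomials in w of degree below n. At w = y_k with k different from i
  both vanish, and at w = y_i they agree. This gives the ratio of Vandermonde determinants without
  their product formula.\<close>

lemma alternant_at_delta_update:
  fixes y :: "nat \<Rightarrow> 'a :: field"
  assumes inj: "inj_on y {..<n}" and i: "i < n"
  shows "alternant_at n (y(i := w)) (\<lambda>j. n - 1 - j) * (\<Prod>k\<in>{..<n} - {i}. y i - y k) =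
         alternant_at n y (\<lambda>j. n - 1 - j) * (\<Prod>k\<in>{..<n} - {i}. w - y k)"
proof -
  let ?\<delta> = "\<lambda>j. n - 1 - j" and ?A = "{..<n} - {i}"
  obtain P where "\<forall>k\<ge>n. coeff P k = 0" "\<forall>w. poly P w = alternant_at n (y(i := w)) ?\<delta>"
    using alternant_at_delta_row_poly[OF i] by blast
  then have P: "\<And>k. k \<ge> n \<Longrightarrow> coeff P k = 0" "\<And>w. poly P w = alternant_at n (y(i := w)) ?\<delta>"
    by blast+
  define Q where "Q = (\<Prod>k\<in>?A. [:- y k, 1:])"
  have Q: "poly Q w = (\<Prod>k\<in>?A. w - y k)" for w by (simp add: Q_def poly_prod)
  have degQ: "coeff Q k = 0" if "k \<ge> n" for k
  proof (rule coeff_eq_0)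
    have "degree Q \<le> sum (degree \<circ> (\<lambda>k. [:- y k, 1:])) ?A"
      unfolding Q_def by (rule degree_prod_sum_le) simp
    also have "\<dots> = n - 1" using i by simp
    finally show "degree Q < k" using i that by linarith
  qed
  have yi: "alternant_at n (y(i := y i)) ?\<delta> = alternant_at n y ?\<delta>" by simp
  have "Polynomial.smult (poly Q (y i)) P - Polynomial.smult (alternant_at n y ?\<delta>) Q = 0"
  proof (rule poly_eq_0_if_roots[OF inj])
    fix k assume "k < n"
    show "poly (Polynomial.smult (poly Q (y i)) P - Polynomial.smult (alternant_at n y ?\<delta>) Q) (y k) = 0"
    proof (cases "k = i")
      case True
      then show ?thesis by (simp add: P(2))
    next
      case False
      then have "poly Q (y k) = 0" unfolding Q using \<open>k < n\<close> by (intro prod_zero) auto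
      moreover have "poly P (y k) = 0"
        unfolding P(2) using False i \<open>k < n\<close> by (intro alternant_at_identical[of i n k]) auto
      ultimately show ?thesis by simp
    qed
  qed (simp add: P(1) degQ)
  then have "poly (Polynomial.smult (poly Q (y i)) P) w = poly (Polynomial.smult (alternant_at n y ?\<delta>) Q) w" by simp
  then show ?thesis by (simp add: P(2) Q mult.commute)
qed

text \<open>The factor with j = i in the numerator of the residue gives 1 - 1/a, the other n - 1
  factors give 1/a each, and the powers of y_i cancel against the denominator.\<close>

lemma residue_alternant:
  fixes y :: "nat \<Rightarrow> 'a :: field"
  assumes inj: "inj_on y {..<n}" and nz: "\<forall>i<n. y i \<noteq> 0" and a: "a \<noteq> 0" and i: "i < n"
  shows "residue n a y i * alternant_at n y (\<lambda>j. n - 1 - j) =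
         (1 - 1 / a) * (1 / a) ^ (n - 1) * alternant_at n (y(i := a * y i)) (\<lambda>j. n - 1 - j)"
proof -
  let ?A = "{..<n} - {i}" and ?\<delta> = "\<lambda>j. n - 1 - j"
  let ?D = "\<Prod>k\<in>?A. y i - y k" and ?N = "\<Prod>k\<in>?A. a * y i - y k"
  have yi: "y i \<noteq> 0" using nz i by blast
  have D: "?D \<noteq> 0" using inj i by (auto simp: inj_on_def)
  have card: "card ?A = n - 1" using i by simp
  have "(\<Prod>j<n. 1 - y j / (a * y i)) = (1 - 1 / a) * (\<Prod>j\<in>?A. 1 - y j / (a * y i))"
    using i yi by (subst prod.remove[of _ i]) (auto simp: mult.commute)
  also have "(\<Prod>j\<in>?A. 1 - y j / (a * y i)) = (\<Prod>j\<in>?A. (1 / a) * ((1 / y i) * (a * y i - y j)))"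
    using a yi by (intro prod.cong) (auto simp: field_simps)
  also have "\<dots> = (1 / a) ^ (n - 1) * ((1 / y i) ^ (n - 1) * ?N)"
    by (simp only: prod.distrib prod_constant card)
  finally have 1: "(\<Prod>j<n. 1 - y j / (a * y i)) =
    (1 - 1 / a) * ((1 / a) ^ (n - 1) * ((1 / y i) ^ (n - 1) * ?N))" .
  have "(\<Prod>j\<in>?A. 1 - y j / y i) = (\<Prod>j\<in>?A. (1 / y i) * (y i - y j))"
    using yi by (intro prod.cong) (auto simp: field_simps)
  also have "\<dots> = (1 / y i) ^ (n - 1) * ?D" by (simp only: prod.distrib prod_constant card)
  finally have 2: "(\<Prod>j\<in>?A. 1 - y j / y i) = (1 / y i) ^ (n - 1) * ?D" .
  have cancel: "c * (p * (z * N)) / (z * D) = c * p * (N / D)" if "z \<noteq> 0" for c p z N D :: 'a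
    using that by (simp add: mult.left_commute[of _ z] mult.assoc)
  have "(1 / y i) ^ (n - 1) \<noteq> 0" using yi by simp
  then have res: "residue n a y i = (1 - 1 / a) * (1 / a) ^ (n - 1) * (?N / ?D)"
    unfolding residue_def 1 2 by (rule cancel)
  have "alternant_at n (y(i := a * y i)) ?\<delta> = alternant_at n y ?\<delta> * ?N / ?D"
    using alternant_at_delta_update[OF inj i, of "a * y i"] by (simp only: nonzero_eq_divide_eq[OF D])
  then show ?thesis unfolding res by (simp only: times_divide_eq_right times_divide_eq_left mult_ac)
qed

text \<open>In the Leibniz term of p, row i meets column p(i): scaling y_i gives the factor a to the
  power alpha_{p(i)}, and y_i^v raises the exponent of that column by v.\<close>

lemma sum_scaled_alternants:
  fixes y :: "nat \<Rightarrow> 'a :: comm_ring_1"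
  shows "(\<Sum>i<n. y i ^ v * alternant_at n (y(i := a * y i)) \<alpha>) =
         (\<Sum>j<n. a ^ \<alpha> j * alternant_at n y (\<alpha>(j := \<alpha> j + v)))"
proof -
  let ?S = "{p. p permutes {0..<n}}"
  let ?w = "\<lambda>p. \<Prod>k<n. y k ^ \<alpha> (p k)"
  have L: "y i ^ v * (\<Prod>k<n. (y(i := a * y i)) k ^ \<alpha> (p k)) = a ^ \<alpha> (p i) * y i ^ v * ?w p"
    if "i < n" for i and p :: "nat \<Rightarrow> nat"
  proof -
    have "(\<Prod>k<n. (y(i := a * y i)) k ^ \<alpha> (p k)) = (a * y i) ^ \<alpha> (p i) * (\<Prod>k\<in>{..<n} - {i}. y k ^ \<alpha> (p k))"
      using that by (subst prod.remove[of _ i]) auto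
    moreover have "?w p = y i ^ \<alpha> (p i) * (\<Prod>k\<in>{..<n} - {i}. y k ^ \<alpha> (p k))"
      using that by (subst prod.remove[of _ i]) auto
    ultimately show ?thesis by (simp add: power_mult_distrib mult_ac)
  qed
  have R: "(\<Prod>k<n. y k ^ (\<alpha>(p i := \<alpha> (p i) + v)) (p k)) = y i ^ v * ?w p"
    if "i < n" "p permutes {0..<n}" for i p
  proof -
    have "p k \<noteq> p i" if "k \<noteq> i" for k
      using that permutes_inj[OF \<open>p permutes _\<close>] by (auto dest: injD)
    then have "(\<Prod>k\<in>{..<n} - {i}. y k ^ (\<alpha>(p i := \<alpha> (p i) + v)) (p k)) = (\<Prod>k\<in>{..<n} - {i}. y k ^ \<alpha> (p k))"
      by (intro prod.cong) auto
    then show ?thesis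
      using that by (simp add: prod.remove[of "{..<n}" i] power_add mult_ac)
  qed
  have "(\<Sum>i<n. y i ^ v * alternant_at n (y(i := a * y i)) \<alpha>) =
    (\<Sum>i<n. \<Sum>p\<in>?S. signof p * (a ^ \<alpha> (p i) * y i ^ v * ?w p))"
    unfolding alternant_at_leibniz sum_distrib_left
  proof (intro sum.cong refl)
    fix i p assume "i \<in> {..<n}"
    then show "y i ^ v * (signof p * (\<Prod>k<n. (y(i := a * y i)) k ^ \<alpha> (p k))) =
        signof p * (a ^ \<alpha> (p i) * y i ^ v * ?w p)"
      using L[of i p] by (simp only: lessThan_iff mult.left_commute[of _ "signof p"])
  qed
  also have "\<dots> = (\<Sum>p\<in>?S. \<Sum>i<n. signof p * (a ^ \<alpha> (p i) * y i ^ v * ?w p))"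
    by (rule sum.swap)
  also have "\<dots> = (\<Sum>p\<in>?S. \<Sum>j<n. signof p * (a ^ \<alpha> j * (\<Prod>k<n. y k ^ (\<alpha>(j := \<alpha> j + v)) (p k))))"
  proof (rule sum.cong[OF refl])
    fix p assume "p \<in> ?S"
    then have p: "p permutes {0..<n}" by simp
    \<comment> \<open>For each fixed p the substitution j = p(i) turns the sum over rows into a sum
      over columns.\<close>
    then have "bij_betw p {..<n} {..<n}" using permutes_imp_bij by (simp add: atLeast0LessThan)
    then have "(\<Sum>j<n. signof p * (a ^ \<alpha> j * (\<Prod>k<n. y k ^ (\<alpha>(j := \<alpha> j + v)) (p k)))) =
      (\<Sum>i<n. signof p * (a ^ \<alpha> (p i) * (\<Prod>k<n. y k ^ (\<alpha>(p i := \<alpha> (p i) + v)) (p k))))"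
      by (rule sum.reindex_bij_betw[symmetric])
    also have "\<dots> = (\<Sum>i<n. signof p * (a ^ \<alpha> (p i) * y i ^ v * ?w p))"
      by (intro sum.cong refl) (simp only: R[OF _ p] lessThan_iff mult.assoc)
    finally show "(\<Sum>i<n. signof p * (a ^ \<alpha> (p i) * y i ^ v * ?w p)) =
      (\<Sum>j<n. signof p * (a ^ \<alpha> j * (\<Prod>k<n. y k ^ (\<alpha>(j := \<alpha> j + v)) (p k))))" ..
  qed
  also have "\<dots> = (\<Sum>j<n. \<Sum>p\<in>?S. signof p * (a ^ \<alpha> j * (\<Prod>k<n. y k ^ (\<alpha>(j := \<alpha> j + v)) (p k))))"
    by (rule sum.swap)
  also have "\<dots> = (\<Sum>j<n. a ^ \<alpha> j * alternant_at n y (\<alpha>(j := \<alpha> j + v)))"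
    unfolding alternant_at_leibniz sum_distrib_left by (intro sum.cong refl) (simp add: mult_ac)
  finally show ?thesis .
qed

section \<open>The main identity\<close>

lemma one_minus_q_power_neq_0: "k > 0 \<Longrightarrow> 1 - q ^ k \<noteq> 0"
  using q_power_neq_1[of k] by simp

lemma one_minus_q_neq_0: "1 - q \<noteq> 0"
  using one_minus_q_power_neq_0[of 1] by simp

lemma adams_q_divide:
  assumes k: "k > 0"
  shows "adams_q k (x / y) = adams_q k x / adams_q k y"
proof (cases "y = 0")
  case True
  interpret a: comm_ring_hom "adams_q k" by (rule comm_ring_hom_adams_q[OF k])
  show ?thesis using True by simp
next
  case False
  interpret a: comm_ring_hom "adams_q k" by (rule comm_ring_hom_adams_q[OF k])
  have "adams_q k y * adams_q k (1 / y) = 1" using False by (simp flip: a.hom_mult)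
  then have "adams_q k y \<noteq> 0" by auto
  moreover have "adams_q k (x / y) * adams_q k y = adams_q k x"
    using False by (simp flip: a.hom_mult)
  ultimately show ?thesis by (simp add: nonzero_eq_divide_eq)
qed

lemma adams_q_scalars:
  assumes k: "k > 0"
  shows "adams_q k (1 / (1 - q)) = 1 / (1 - q ^ k)"
    and "adams_q k (bracket t (int u)) = (1 - (1 / q ^ k) ^ u) / (1 - 1 / q ^ k)"
    and "adams_q k (M * bracket q (int u)) = (1 - 1 / q ^ k) * (1 - (q ^ k) ^ u)"
proof -
  interpret a: comm_ring_hom "adams_q k" by (rule comm_ring_hom_adams_q[OF k])
  note simps = a.hom_minus a.hom_mult a.hom_power adams_q_divide[OF k] adams_q_q[OF k]
  show "adams_q k (1 / (1 - q)) = 1 / (1 - q ^ k)" by (simp add: simps)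
  show "adams_q k (bracket t (int u)) = (1 - (1 / q ^ k) ^ u) / (1 - 1 / q ^ k)"
    by (simp add: simps bracket_def t_def)
  have "M * bracket q (int u) = (1 - 1 / q) * (1 - q ^ u)"
    using one_minus_q_neq_0 by (simp add: M_def bracket_def t_def)
  then show "adams_q k (M * bracket q (int u)) = (1 - 1 / q ^ k) * (1 - (q ^ k) ^ u)"
    by (simp add: simps)
qed

section \<open>Specialization of X/(1-q) to a finite set of points\<close>

text \<open>The specialization with X/(1-q) = y_1 + ... + y_n, that is, p_k[X] = (1 - q^k)
  p_k(y).\<close>

definition scaled_ev :: "nat \<Rightarrow> (nat \<Rightarrow> qfield) \<Rightarrow> symfun \<Rightarrow> qfield" where
  "scaled_ev n y = ev (\<lambda>k. (1 - q ^ k) * pow_sums n y k)"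

interpretation scaled_ev: comm_ring_hom "scaled_ev n y"
  unfolding scaled_ev_def by (rule ev.comm_ring_hom_axioms)

lemma scaled_ev_scal [simp]: "scaled_ev n y (scal c) = c"
  by (simp add: scaled_ev_def)

lemma scaled_ev_psum: "k > 0 \<Longrightarrow> scaled_ev n y (psum k) = (1 - q ^ k) * pow_sums n y k"
  by (simp add: scaled_ev_def)

lemma scaled_ev_pleth: "scaled_ev n y (pleth F (scal (1 / (1 - q)) * X)) = ev (pow_sums n y) F"
  unfolding pleth_def
proof (rule symfun_hom_eqI[where f = "\<lambda>F. scaled_ev n y (subst_psum scal (\<lambda>k. adams k (scal (1 / (1 - q)) * X)) F)"
      and g = "ev (pow_sums n y)"])
  show "comm_ring_hom (\<lambda>F. scaled_ev n y (subst_psum scal (\<lambda>k. adams k (scal (1 / (1 - q)) * X)) F))"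
    by (rule comm_ring_hom_comp[OF scaled_ev.comm_ring_hom_axioms scal.comm_ring_hom_subst_psum])
  fix k :: nat assume k: "k > 0"
  interpret a: comm_ring_hom "adams k" by (rule comm_ring_hom_adams[OF k])
  show "scaled_ev n y (subst_psum scal (\<lambda>k. adams k (scal (1 / (1 - q)) * X)) (psum k)) = ev (pow_sums n y) (psum k)"
    using k one_minus_q_power_neq_0[OF k]
    by (simp add: a.hom_mult adams_scal adams_X adams_q_scalars scaled_ev.hom_mult scaled_ev_psum)
qed (simp_all add: ev.comm_ring_hom_axioms)

text \<open>No 1 - q^k with k > 0 vanishes, so rescaling each p_k by it is invertible, with inverse
  \<open>?T\<close>, and detection of zero by points carries over.\<close>

lemma scaled_ev_eq_0_imp_eq_0:
  assumes "\<And>n y. n \<ge> N \<Longrightarrow> inj_on y {..<n} \<Longrightarrow> (\<forall>i<n. y i \<noteq> 0) \<Longrightarrow> scaled_ev n y F = 0"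
  shows "F = 0"
proof -
  let ?S = "subst_psum scal (\<lambda>k. scal (1 - q ^ k) * psum k)"
  let ?T = "subst_psum scal (\<lambda>k. scal (1 / (1 - q ^ k)) * psum k)"
  have S: "ev (pow_sums n y) (?S F) = scaled_ev n y F" for n y
    by (rule symfun_hom_eqI[where f = "\<lambda>F. ev (pow_sums n y) (?S F)" and g = "scaled_ev n y"])
       (simp_all add: comm_ring_hom_comp[OF ev.comm_ring_hom_axioms scal.comm_ring_hom_subst_psum]
          scaled_ev.comm_ring_hom_axioms scaled_ev_psum ev.hom_mult)
  have "?S F = 0"
    by (rule ev_pow_sums_eq_0_imp_eq_0[of N]) (simp add: S assms)
  interpret T: comm_ring_hom ?T by (rule scal.comm_ring_hom_subst_psum)
  have "?T (?S F) = F"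
  proof (rule symfun_hom_eqI[where f = "\<lambda>F. ?T (?S F)" and g = "\<lambda>F. F"])
    show "comm_ring_hom (\<lambda>F. ?T (?S F))"
      by (rule comm_ring_hom_comp[OF T.comm_ring_hom_axioms scal.comm_ring_hom_subst_psum])
    fix k :: nat assume k: "k > 0"
    have "?T (?S (psum k)) = scal ((1 - q ^ k) * (1 / (1 - q ^ k))) * psum k"
      using k by (simp only: scal.subst_psum_psum T.hom_mult scal.subst_psum_scal scal.hom_mult mult.assoc)
    then show "?T (?S (psum k)) = psum k"
      using one_minus_q_power_neq_0[OF k] by simp
  qed (simp_all add: comm_ring_hom_id)
  then show ?thesis using \<open>?S F = 0\<close> by simp
qed

lemma pow_sums_update:
  assumes "i < n"
  shows "pow_sums n (y(i := a * y i)) k = pow_sums n y k + (a ^ k - 1) * y i ^ k"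
proof -
  have "pow_sums n (y(i := a * y i)) k = (a * y i) ^ k + (\<Sum>j\<in>{..<n} - {i}. y j ^ k)"
    unfolding pow_sums_def using assms by (subst sum.remove[of _ i]) auto
  moreover have "pow_sums n y k = y i ^ k + (\<Sum>j\<in>{..<n} - {i}. y j ^ k)"
    unfolding pow_sums_def using assms by (subst sum.remove[of _ i]) auto
  ultimately show ?thesis by (simp add: power_mult_distrib algebra_simps)
qed

lemma scaled_ev_D:
  assumes inj: "inj_on y {..<n}" and nz: "\<forall>i<n. y i \<noteq> 0" and V: "V > 0"
  shows "scaled_ev n y (D (int U) (int V) (pleth F (scal (1 / (1 - q)) * X))) =
    (\<Sum>i<n. residue n (q ^ U) y i * (q * y i) ^ V * ev (pow_sums n (y(i := q ^ U * y i))) F)"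
proof -
  define a where "a = q ^ U"
  have a: "a \<noteq> 0" by (simp add: a_def)
  define s where "s = - (scal (bracket t (int U)) * X)"
  have E: "- (fls_X * scal_z (bracket t (int U)) * fls_const X) = fls_const s * fls_X"
    by (simp add: s_def scal_z_def mult_ac flip: fls_const_mult_const)
  define x where "x i = q * y i" for i
  have x: "inj_on x {..<n}" "\<forall>i<n. x i \<noteq> 0" using inj nz by (auto simp: x_def inj_on_def)
  let ?B = "Omega (fls_const s * fls_X)"
  have "Abs_fps (\<lambda>m. scaled_ev n y (fls_nth ?B (int m))) * root_prod n x = root_prod n (\<lambda>j. x j / a)"
  proof (rule hom_Omega_linear[OF scaled_ev.comm_ring_hom_axioms scaled_ev_scal])
    fix k :: nat assume k: "k > 0"
    interpret ad: comm_ring_hom "adams k" by (rule comm_ring_hom_adams[OF k])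
    have "q ^ k \<noteq> 1" by (rule q_power_neq_1[OF k])
    \<comment> \<open>The factor 1 - q^k from the specialization cancels the denominator of [u]_t up
      to -q^k. This shows p_k of the argument as the difference of the k-th power sums of the q y_j
      and of the q y_j / a.\<close>
    then have "- ((1 - (1 / q ^ k) ^ U) / (1 - 1 / q ^ k)) * (1 - q ^ k) = q ^ k * (1 - (1 / q ^ k) ^ U)"
      by (simp add: field_simps)
    moreover have "scaled_ev n y (adams k s) =
        - ((1 - (1 / q ^ k) ^ U) / (1 - 1 / q ^ k)) * (1 - q ^ k) * pow_sums n y k"
      using k by (simp add: s_def ad.hom_uminus ad.hom_mult adams_scal adams_X adams_q_scalars
          scaled_ev.hom_uminus scaled_ev.hom_mult scaled_ev_psum)
    ultimately have "scaled_ev n y (adams k s) = q ^ k * (1 - (1 / q ^ k) ^ U) * pow_sums n y k" by simp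
    moreover have "pow_sums n x k = q ^ k * pow_sums n y k"
      by (simp add: pow_sums_def x_def power_mult_distrib sum_distrib_left)
    moreover have "pow_sums n (\<lambda>j. x j / a) k = q ^ k * (1 / q ^ k) ^ U * pow_sums n y k"
      by (simp add: pow_sums_def x_def a_def power_mult_distrib sum_distrib_left power_divide
          power_mult[symmetric] mult.commute[of U k] flip: sum_divide_distrib)
    ultimately show "scaled_ev n y (adams k s) = pow_sums n x k - pow_sums n (\<lambda>j. x j / a) k"
      by (simp add: algebra_simps)
  qed
  note coeff = partial_fractions_coeff[OF x a this]
  have B: "scaled_ev n y (fls_nth ?B (int V + int k)) = (\<Sum>i<n. (residue n a y i * x i ^ V) * x i ^ k)" for k
  proof -
    have "scaled_ev n y (fls_nth ?B (int (V + k))) = (\<Sum>i<n. residue n a x i * x i ^ (V + k))"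
      using coeff[of "V + k"] V by simp
    moreover have "residue n a x i = residue n a y i" for i
      unfolding x_def by (rule residue_scale) simp
    ultimately show ?thesis by (simp add: power_add mult.assoc)
  qed
  have "scaled_ev n y (D (int U) (int V) (pleth F (scal (1 / (1 - q)) * X))) =
    (\<Sum>i<n. residue n a y i * x i ^ V * ev (\<lambda>k. adams_q k (1 / (1 - q)) *
       (scaled_ev n y (psum k) + adams_q k (M * bracket q (int U)) * x i ^ k)) F)"
    unfolding D_def E by (rule hom_pleth_z_coeff[OF scaled_ev.comm_ring_hom_axioms scaled_ev_scal B])
  also have "\<dots> = (\<Sum>i<n. residue n a y i * x i ^ V * ev (pow_sums n (y(i := a * y i))) F)"
  proof (rule sum.cong[OF refl])
    fix i assume "i \<in> {..<n}"
    then have i: "i < n" by simp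
    let ?w = "\<lambda>k. adams_q k (1 / (1 - q)) * (scaled_ev n y (psum k) + adams_q k (M * bracket q (int U)) * x i ^ k)"
    have "?w k = pow_sums n (y(i := a * y i)) k" if k: "k > 0" for k
    proof -
      have ne: "1 - q ^ k \<noteq> 0" by (rule one_minus_q_power_neq_0[OF k])
      \<comment> \<open>At 1/z = q y_i the powers of q combine to the factor 1 - q^k, which the
        plethysm by 1/(1-q) divides out; the rest is exactly the effect on p_k of replacing y_i by a
        y_i.\<close>
      have "(1 - 1 / q ^ k) * (1 - (q ^ k) ^ U) * x i ^ k = (1 - q ^ k) * ((a ^ k - 1) * y i ^ k)"
        by (simp add: x_def a_def power_mult_distrib field_simps flip: power_mult)
      then have "?w k = pow_sums n y k + (a ^ k - 1) * y i ^ k"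
        using ne k by (simp add: adams_q_scalars scaled_ev_psum flip: distrib_left)
      then show ?thesis by (simp add: pow_sums_update[OF i])
    qed
    then have "ev ?w F = ev (pow_sums n (y(i := a * y i))) F"
      by - (rule symfun_hom_eqI[of "ev ?w" "ev (pow_sums n (y(i := a * y i)))"],
        simp_all add: ev.comm_ring_hom_axioms)
    then show "residue n a y i * x i ^ V * ev ?w F =
      residue n a y i * x i ^ V * ev (pow_sums n (y(i := a * y i))) F" by simp
  qed
  finally show ?thesis by (simp add: x_def a_def)
qed

lemma scaled_ev_D_schur:
  assumes inj: "inj_on y {..<n}" and nz: "\<forall>i<n. y i \<noteq> 0" and V: "V > 0" and len: "length \<mu> \<le> n"
  shows "scaled_ev n y (D (int U) (int V) (pleth (schur \<mu>) (scal (1 / (1 - q)) * X))) *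
      alternant_at n y (\<lambda>j. n - 1 - j) =
    (\<Sum>j<n. (q ^ U - 1) * q powi (int U * int (part \<mu> j) + int V - int U * int (Suc j)) *
      alternant_at n y ((\<lambda>j. part \<mu> j + (n - 1 - j))(j := part \<mu> j + (n - 1 - j) + V)))"
proof -
  define a where "a = q ^ U"
  have a: "a \<noteq> 0" by (simp add: a_def)
  let ?\<delta> = "\<lambda>j. n - 1 - j" and ?e = "\<lambda>j. part \<mu> j + (n - 1 - j)"
  let ?c = "(1 - 1 / a) * (1 / a) ^ (n - 1)"
  have "scaled_ev n y (D (int U) (int V) (pleth (schur \<mu>) (scal (1 / (1 - q)) * X))) * alternant_at n y ?\<delta> =
    (\<Sum>i<n. (q * y i) ^ V * ev (pow_sums n (y(i := a * y i))) (schur \<mu>) * (residue n a y i * alternant_at n y ?\<delta>))"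
    unfolding scaled_ev_D[OF inj nz V] sum_distrib_right a_def
    by (rule sum.cong[OF refl]) (simp only: mult_ac)
  also have "\<dots> = (\<Sum>i<n. q ^ V * ?c * (y i ^ V * alternant_at n (y(i := a * y i)) ?e))"
  proof (rule sum.cong[OF refl])
    fix i assume "i \<in> {..<n}"
    then have i: "i < n" by simp
    let ?s = "ev (pow_sums n (y(i := a * y i))) (schur \<mu>)" and ?d = "alternant_at n (y(i := a * y i)) ?\<delta>"
    have "(q * y i) ^ V * ?s * (residue n a y i * alternant_at n y ?\<delta>) = (q * y i) ^ V * ?s * (?c * ?d)"
      by (simp only: residue_alternant[OF inj nz a i])
    also have "\<dots> = q ^ V * ?c * (y i ^ V * (?s * ?d))"
      by (simp only: power_mult_distrib mult_ac)
    also have "?s * ?d = alternant_at n (y(i := a * y i)) ?e" by (rule schur_at[OF len])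
    finally show "(q * y i) ^ V * ?s * (residue n a y i * alternant_at n y ?\<delta>) =
      q ^ V * ?c * (y i ^ V * alternant_at n (y(i := a * y i)) ?e)" .
  qed
  also have "\<dots> = q ^ V * ?c * (\<Sum>j<n. a ^ ?e j * alternant_at n y (?e(j := ?e j + V)))"
    unfolding sum_distrib_left[symmetric] sum_scaled_alternants ..
  also have "\<dots> = (\<Sum>j<n. (a - 1) * q powi (int U * int (part \<mu> j) + int V - int U * int (Suc j)) *
      alternant_at n y (?e(j := ?e j + V)))"
    unfolding sum_distrib_left
  proof (rule sum.cong[OF refl])
    fix j assume "j \<in> {..<n}"
    then have j: "j < n" by simp
    \<comment> \<open>Here n disappears: a^(-(n-1)) against a^(n-1-j) leaves a^(-j), and 1 - 1/a =
      (a-1)/a supplies one more 1/a. With j counted from 0 the exponent is that of index i = j +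
      1.\<close>
    have "a ^ (n - 1) = a ^ (n - 1 - j) * a ^ j" using j by (simp flip: power_add)
    then have "q ^ V * ?c * a ^ ?e j = (a - 1) * (q ^ V * a ^ part \<mu> j / a ^ Suc j)"
      using a by (simp add: power_add field_simps)
    also have "q ^ V * a ^ part \<mu> j / a ^ Suc j = q powi (int U * int (part \<mu> j) + int V - int U * int (Suc j))"
    proof -
      have "int U * int (part \<mu> j) + int V - int U * int (Suc j) = int (U * part \<mu> j + V) - int (U * Suc j)"
        by (simp only: of_nat_add of_nat_mult)
      then have "q powi (int U * int (part \<mu> j) + int V - int U * int (Suc j)) =
          q ^ (U * part \<mu> j + V) / q ^ (U * Suc j)"
        by (simp only: power_int_diff[OF disjI1[OF q_neq_0]] power_int_of_nat)
      then show ?thesis by (simp only: a_def power_add power_mult mult.commute)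
    qed
    finally show "q ^ V * ?c * (a ^ ?e j * alternant_at n y (?e(j := ?e j + V))) =
      (a - 1) * q powi (int U * int (part \<mu> j) + int V - int U * int (Suc j)) *
      alternant_at n y (?e(j := ?e j + V))" by (simp only: mult.assoc[symmetric])
  qed
  finally show ?thesis by (simp only: a_def)
qed

theorem theoremI6:
  fixes u v :: int and \<mu> :: "nat list"
  assumes "u > 0" and "v > 0" and "is_partition \<mu>"
  shows "let N = sum_list \<mu> + nat v;
             p = \<mu> @ replicate (N - length \<mu>) 0;
             Y = scal (1 / (1 - q)) * X
         in D u v (pleth (schur \<mu>) Y) =
            scal (q powi u - 1) *
            (\<Sum>i = 1..N.
               scal (q powi (u * int (p ! (i - 1)) + v - u * int i)) *
               pleth (schur_comp (p[i - 1 := p ! (i - 1) + nat v])) Y)"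
proof -
  obtain U V where UV: "u = int U" "v = int V" and V: "V > 0"
    using assms(1,2) by (metis nonneg_int_cases less_imp_le of_nat_0_less_iff)
  define N where "N = sum_list \<mu> + V"
  define p where "p = \<mu> @ replicate (N - length \<mu>) 0"
  define Y where "Y = scal (1 / (1 - q)) * X"
  \<comment> \<open>All parts are positive, so the composition has room for every part and V further
    zeros.\<close>
  have "length \<mu> \<le> sum_list \<mu>"
    using assms(3) unfolding is_partition_def by (induction \<mu>) (auto simp: Suc_le_eq)
  then have lenN: "length \<mu> + V \<le> N" by (simp add: N_def)
  have lp: "length p = N" using lenN by (simp add: p_def)
  have pnth: "p ! j = part \<mu> j" if "j < N" for j
    using that lenN by (auto simp: p_def part_def nth_append)
  define L where "L = D u v (pleth (schur \<mu>) Y)"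
  define R where "R = scal (q powi u - 1) * (\<Sum>i = 1..N.
    scal (q powi (u * int (p ! (i - 1)) + v - u * int i)) * pleth (schur_comp (p[i - 1 := p ! (i - 1) + nat v])) Y)"
  have "L - R = 0"
  proof (rule scaled_ev_eq_0_imp_eq_0[of N])
    fix n and y :: "nat \<Rightarrow> qfield"
    assume n: "n \<ge> N" and inj: "inj_on y {..<n}" and nz: "\<forall>i<n. y i \<noteq> 0"
    let ?\<delta> = "\<lambda>j. n - 1 - j" and ?e = "\<lambda>j. part \<mu> j + (n - 1 - j)"
    let ?k = "\<lambda>j. q powi (int U * int (part \<mu> j) + int V - int U * int (Suc j))"
    \<comment> \<open>Both j and j - V lie beyond the parts of the partition, and adding V to the
      staircase entry at j gives the one at j - V: two columns coincide.\<close>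
    have vanish: "alternant_at n y (?e(j := ?e j + V)) = 0" if "j < n" "j \<ge> N" for j
      using that lenN V by (intro alternant_at_repeated[of j n "j - V"]) (auto simp: part_def)
    have comp: "ev (pow_sums n y) (schur_comp (p[j := p ! j + V])) * alternant_at n y ?\<delta> =
        alternant_at n y (?e(j := ?e j + V))" if "j < N" for j
    proof -
      have "ev (pow_sums n y) (schur_comp (p[j := p ! j + V])) * alternant_at n y ?\<delta> =
        alternant_at n y (\<lambda>i. part (p[j := p ! j + V]) i + (n - 1 - i))"
        by (rule schur_comp_at) (simp add: lp n)
      also have "\<dots> = alternant_at n y (?e(j := ?e j + V))"
      proof (rule alternant_at_cong)
        fix i assume "i < n"
        have "part (p[j := z]) i = (if i = j then z else part \<mu> i)" for z
        proof (cases "i < N")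
          case True
          then show ?thesis using that by (simp add: part_def[of "p[j := z]"] lp nth_list_update pnth)
        next
          case False
          then show ?thesis using that lenN by (auto simp: part_def lp)
        qed
        then have "part (p[j := p ! j + V]) i = (if i = j then part \<mu> j + V else part \<mu> i)"
          using that by (simp add: pnth)
        then show "part (p[j := p ! j + V]) i + (n - 1 - i) = (?e(j := ?e j + V)) i" by simp
      qed
      finally show ?thesis .
    qed
    have "scaled_ev n y L * alternant_at n y ?\<delta> = (\<Sum>j<n. (q ^ U - 1) * ?k j * alternant_at n y (?e(j := ?e j + V)))"
      unfolding L_def Y_def UV using lenN n by (intro scaled_ev_D_schur[OF inj nz V]) simp
    also have "\<dots> = (\<Sum>j<N. (q ^ U - 1) * ?k j * alternant_at n y (?e(j := ?e j + V)))"
      using n vanish by (intro sum.mono_neutral_right) auto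
    also have "\<dots> = (q ^ U - 1) * (\<Sum>j<N. ?k j * ev (pow_sums n y) (schur_comp (p[j := p ! j + V]))) * alternant_at n y ?\<delta>"
      unfolding sum_distrib_left sum_distrib_right
      by (rule sum.cong[OF refl]) (simp only: comp lessThan_iff mult.assoc)
    also have "(\<Sum>j<N. ?k j * ev (pow_sums n y) (schur_comp (p[j := p ! j + V]))) =
      (\<Sum>i = 1..N. q powi (u * int (p ! (i - 1)) + v - u * int i) *
         ev (pow_sums n y) (schur_comp (p[i - 1 := p ! (i - 1) + nat v])))"
      by (rule sum.reindex_bij_witness[of _ "\<lambda>i. i - 1" Suc]) (auto simp: UV pnth)
    also have "(q ^ U - 1) * \<dots> = scaled_ev n y R"
      by (simp add: R_def scaled_ev.hom_mult scaled_ev.hom_sum Y_def scaled_ev_pleth UV)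
    finally have "scaled_ev n y L * alternant_at n y ?\<delta> = scaled_ev n y R * alternant_at n y ?\<delta>" .
    then show "scaled_ev n y (L - R) = 0"
      using alternant_at_delta_neq_0[OF inj] by (simp add: scaled_ev.hom_minus)
  qed
  then show ?thesis
    by (simp add: Let_def L_def R_def N_def p_def Y_def UV)
qed

end
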